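(* Let $d\ge2$, $1\le\mu<d$, let $\boldsymbol\alpha,\boldsymbol\gamma\in\mathbb{R}^d$ be such that $$\tfrac12<\alpha_1=\gamma_1=\dots=\alpha_\mu=\gamma_\mu<\alpha_{\mu+1}\le\dots\le\alpha_d\qquad\text{and}\qquad \alpha_1<\gamma_s<\alpha_s,\quad s=\mu+1,\dots,d,$$ and let the refinement $R\ge1$ be given. Assume that $\Lambda(\boldsymbol z,M)$ is a reconstructing rank-1 lattice for $H_R^{d,\boldsymbol\gamma}$ constructed by the CBC strategy. Then $$\big\|\mathrm{Id}-S_{H_R^{d,\boldsymbol\gamma}}^{\Lambda(\boldsymbol z,M)}\big|\mathcal{H}^{\boldsymbol\alpha}_{\mathrm{mix}}(\mathbb{T}^d)\to L_\infty(\mathbb{T}^d)\big\|\lesssim 2^{-(\alpha_1-\frac12)R}R^{\frac{\mu-1}{2}}\lesssim M^{-(\alpha_1-\frac12)/2}(\log M)^{\frac{\mu-1}{2}(\alpha_1+\frac12)}.$$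
   Context: $\mathbb{T}=[0,1)$ is the torus, $\hat f_{\boldsymbol k}=\int_{\mathbb{T}^d}f(\boldsymbol x)e^{-2\pi i\boldsymbol k\cdot\boldsymbol x}\,d\boldsymbol x$. For $\boldsymbol\alpha\in\mathbb{R}^d$ with positive entries, $\mathcal{H}^{\boldsymbol\alpha}_{\mathrm{mix}}(\mathbb{T}^d)$ is the space of $f\in L_2(\mathbb{T}^d)$ with finite norm $$\|f|\mathcal{H}^{\boldsymbol\alpha}_{\mathrm{mix}}(\mathbb{T}^d)\|^2=\sum_{\boldsymbol k\in\mathbb{Z}^d}|\hat f_{\boldsymbol k}|^2\prod_{s=1}^d(1+|k_s|^2)^{\alpha_s}.$$ Under the hypotheses its elements are continuous (after choosing the continuous representative). Anisotropic hyperbolic cross: $Q_0=\{-1,0,1\}$, $Q_j=([-2^j,-2^{j-1}-1]\cup[2^{j-1}+1,2^j])\cap\mathbb{Z}$ for $j\ge1$, $Q_{\boldsymbol j}=Q_{j_1}\times\dots\times Q_{j_d}$; $J_R^{d,\boldsymbol\gamma}=\{\boldsymbol j\in\mathbb{N}_0^d:\frac1{\gamma_1}\boldsymbol\gamma\cdot\boldsymbol j\le R\}$ and $H_R^{d,\boldsymbol\gamma}=\bigcup_{\boldsymbol j\in J_R^{d,\boldsymbol\gamma}}Q_{\boldsymbol j}$. For $\boldsymbol z\in\mathbb{Z}^d$, $M\in\mathbb{N}$, the rank-1 lattice with generating vector $\boldsymbol z$ and size $M$ is $\Lambda(\boldsymbol z,M)=\{\frac jM\boldsymbol z\bmod\boldsymbol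 1:j=0,\dots,M-1\}$. For finite $I\subset\mathbb{Z}^d$ the sampling operator is $$S_I^{\Lambda(\boldsymbol z,M)}f=\sum_{\boldsymbol k\in I}\hat f_{\boldsymbol k}^{\Lambda(\boldsymbol z,M)}e^{2\pi i\boldsymbol k\cdot\circ},\qquad \hat f_{\boldsymbol k}^{\Lambda(\boldsymbol z,M)}=\frac1M\sum_{j=0}^{M-1}f\big(\tfrac jM\boldsymbol z\big)e^{-2\pi i\frac jM\boldsymbol k\cdot\boldsymbol z}.$$ $\Lambda(\boldsymbol z,M)$ is a reconstructing rank-1 lattice for $I$ if $S_I^{\Lambda(\boldsymbol z,M)}p=p$ for all trigonometric polynomials $p$ with frequencies in $I$; equivalently $\boldsymbol k^1\cdot\boldsymbol z\not\equiv\boldsymbol k^2\cdot\boldsymbol z\pmod M$ for all distinct $\boldsymbol k^1,\boldsymbol k^2\in I$. The CBC (component-by-component) strategy is the search algorithm of Table 3.1 in L. Kämmerer's dissertation: it constructs the generating vector $\boldsymbol z$ of a reconstructing rank-1 lattice component by component, iteratively increasing the dimension of the index set for which the reconstruction property should hold. For $H_R^{d,\boldsymbol\gamma}$ there exist reconstructing rank-1 lattices of size $|H_R^{d,\boldsymbol\gamma}|\le M\lesssim 2^{2R}R^{\mu-1}$, and this bound on the number of points is the one used for the CBC-constructed lattice. $\|A|X\to Y\|$ is the operator norm; $a\lesssim b$ means $a\le c\,b$ with a constant $c>0$ independent of $R,\boldsymbol z,M$. *)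

theory Defs
  imports "HOL-Probability.Probability" "HOL-Probability.Essential_Supremum"
begin

text \<open>
  Vectors of length \<open>d\<close> are functions on \<open>nat\<close> of which only the entries \<open>1, ..., d\<close> matter;
  index sets consist of functions that are \<open>undefined\<close> outside \<open>{1..d}\<close>.
\<close>

definition dotp :: "nat \<Rightarrow> (nat \<Rightarrow> int) \<Rightarrow> (nat \<Rightarrow> real) \<Rightarrow> real" where
  "dotp d k x = (\<Sum>s\<in>{1..d}. of_int (k s) * x s)"

definition trig :: "nat \<Rightarrow> (nat \<Rightarrow> int) \<Rightarrow> (nat \<Rightarrow> real) \<Rightarrow> complex" where
  "trig d k x = exp (2 * of_real pi * \<i> * of_real (dotp d k x))"

definition freqs :: "nat \<Rightarrow> (nat \<Rightarrow> int) set" where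
  "freqs d = {1..d} \<rightarrow>\<^sub>E UNIV"

definition torus :: "nat \<Rightarrow> (nat \<Rightarrow> real) measure" where
  "torus d = Pi\<^sub>M {1..d} (\<lambda>_. restrict_space lborel {0..<1})"

text \<open>
  Functions on the torus are functions that are 1-periodic in each of the first \<open>d\<close>
  coordinates and independent of the others.
\<close>

definition torus_fun :: "nat \<Rightarrow> ((nat \<Rightarrow> real) \<Rightarrow> complex) \<Rightarrow> bool" where
  "torus_fun d f \<longleftrightarrow> (\<forall>x y. (\<forall>s\<in>{1..d}. x s - y s \<in> \<int>) \<longrightarrow> f x = f y)"

definition fourier_coeff :: "nat \<Rightarrow> ((nat \<Rightarrow> real) \<Rightarrow> complex) \<Rightarrow> (nat \<Rightarrow> int) \<Rightarrow> complex" where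
  "fourier_coeff d f k =
     (LINT x|torus d. f x * exp (- 2 * of_real pi * \<i> * of_real (dotp d k x)))"

definition L2_torus :: "nat \<Rightarrow> ((nat \<Rightarrow> real) \<Rightarrow> complex) set" where
  "L2_torus d = {f. torus_fun d f \<and> f \<in> borel_measurable (torus d) \<and>
                    integrable (torus d) (\<lambda>x. (cmod (f x))\<^sup>2)}"

definition hmix_term ::
  "nat \<Rightarrow> (nat \<Rightarrow> real) \<Rightarrow> ((nat \<Rightarrow> real) \<Rightarrow> complex) \<Rightarrow> (nat \<Rightarrow> int) \<Rightarrow> real" where
  "hmix_term d \<alpha> f k =
     (cmod (fourier_coeff d f k))\<^sup>2 * (\<Prod>s\<in>{1..d}. (1 + \<bar>of_int (k s)\<bar>\<^sup>2) powr \<alpha> s)"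

definition Hmix :: "nat \<Rightarrow> (nat \<Rightarrow> real) \<Rightarrow> ((nat \<Rightarrow> real) \<Rightarrow> complex) set" where
  "Hmix d \<alpha> = {f \<in> L2_torus d. hmix_term d \<alpha> f summable_on freqs d}"

definition hmix_norm :: "nat \<Rightarrow> (nat \<Rightarrow> real) \<Rightarrow> ((nat \<Rightarrow> real) \<Rightarrow> complex) \<Rightarrow> real" where
  "hmix_norm d \<alpha> f = sqrt (\<Sum>\<^sub>\<infinity>k\<in>freqs d. hmix_term d \<alpha> f k)"

definition Linf_norm :: "nat \<Rightarrow> ((nat \<Rightarrow> real) \<Rightarrow> complex) \<Rightarrow> ennreal" where
  "Linf_norm d f = esssup (torus d) (\<lambda>x. ennreal (cmod (f x)))"

text \<open>
  Elements of \<open>Hmix\<close> are represented by their continuous representatives, so that point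
  evaluations make sense; continuity refers to the product topology, which for functions of
  the first \<open>d\<close> coordinates is the usual one.  The operator norm takes values in \<open>ennreal\<close>:
  it is \<open>\<infinity>\<close> for unbounded operators.
\<close>

definition opnorm_Hmix_Linf ::
  "nat \<Rightarrow> (nat \<Rightarrow> real) \<Rightarrow> (((nat \<Rightarrow> real) \<Rightarrow> complex) \<Rightarrow> (nat \<Rightarrow> real) \<Rightarrow> complex) \<Rightarrow> ennreal" where
  "opnorm_Hmix_Linf d \<alpha> A =
     (SUP f \<in> {f \<in> Hmix d \<alpha>. continuous_on UNIV f \<and> hmix_norm d \<alpha> f \<le> 1}. Linf_norm d (A f))"

definition Qset :: "nat \<Rightarrow> int set" where
  "Qset j = (if j = 0 then {-1, 0, 1}
             else {- (2 ^ j) .. - (2 ^ (j - 1)) - 1} \<union> {2 ^ (j - 1) + 1 .. 2 ^ j})"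

definition Jset :: "nat \<Rightarrow> (nat \<Rightarrow> real) \<Rightarrow> real \<Rightarrow> (nat \<Rightarrow> nat) set" where
  "Jset d \<gamma> R = {j \<in> {1..d} \<rightarrow>\<^sub>E UNIV. 1 / \<gamma> 1 * (\<Sum>s\<in>{1..d}. \<gamma> s * real (j s)) \<le> R}"

definition hyp_cross :: "nat \<Rightarrow> (nat \<Rightarrow> real) \<Rightarrow> real \<Rightarrow> (nat \<Rightarrow> int) set" where
  "hyp_cross d \<gamma> R = (\<Union>j\<in>Jset d \<gamma> R. \<Pi>\<^sub>E s\<in>{1..d}. Qset (j s))"

text \<open>
  Nodes are not reduced modulo 1; this is immaterial for periodic functions.
\<close>

definition lattice_node :: "(nat \<Rightarrow> int) \<Rightarrow> nat \<Rightarrow> nat \<Rightarrow> nat \<Rightarrow> real" where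
  "lattice_node z M j = (\<lambda>s. real j / real M * of_int (z s))"

definition lattice_coeff ::
  "nat \<Rightarrow> (nat \<Rightarrow> int) \<Rightarrow> nat \<Rightarrow> ((nat \<Rightarrow> real) \<Rightarrow> complex) \<Rightarrow> (nat \<Rightarrow> int) \<Rightarrow> complex" where
  "lattice_coeff d z M f k = 1 / of_nat M *
     (\<Sum>j<M. f (lattice_node z M j) *
        exp (- 2 * of_real pi * \<i> * of_real (dotp d k (lattice_node z M j))))"

definition lattice_sampling ::
  "nat \<Rightarrow> (nat \<Rightarrow> int) \<Rightarrow> nat \<Rightarrow> (nat \<Rightarrow> int) set \<Rightarrow>
   ((nat \<Rightarrow> real) \<Rightarrow> complex) \<Rightarrow> (nat \<Rightarrow> real) \<Rightarrow> complex" where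
  "lattice_sampling d z M I f = (\<lambda>x. \<Sum>k\<in>I. lattice_coeff d z M f k * trig d k x)"

definition trig_polys :: "nat \<Rightarrow> (nat \<Rightarrow> int) set \<Rightarrow> ((nat \<Rightarrow> real) \<Rightarrow> complex) set" where
  "trig_polys d I = {p. \<exists>c. p = (\<lambda>x. \<Sum>k\<in>I. c k * trig d k x)}"

definition reconstructing :: "nat \<Rightarrow> (nat \<Rightarrow> int) \<Rightarrow> nat \<Rightarrow> (nat \<Rightarrow> int) set \<Rightarrow> bool" where
  "reconstructing d z M I \<longleftrightarrow> (\<forall>p\<in>trig_polys d I. lattice_sampling d z M I p = p)"

text \<open>
  \<open>cbc M I s z\<close>: the first \<open>s\<close> components of \<open>z\<close> are a possible outcome of \<open>s\<close> steps of the
  component-by-component search for a lattice of size \<open>M\<close>.  Step \<open>s\<close> appends a component such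
  that the lattice in dimension \<open>s\<close> is reconstructing for the projection of \<open>I\<close> to the first
  \<open>s\<close> coordinates.  The candidate set and the order in which candidates are tried are left
  open, so every run of the search is covered.
\<close>

inductive cbc :: "nat \<Rightarrow> (nat \<Rightarrow> int) set \<Rightarrow> nat \<Rightarrow> (nat \<Rightarrow> int) \<Rightarrow> bool"
  for M :: nat and I :: "(nat \<Rightarrow> int) set" where
  start: "cbc M I 0 (\<lambda>_. undefined)"
| step: "cbc M I s z \<Longrightarrow>
         reconstructing (Suc s) (z(Suc s := c)) M ((\<lambda>k. restrict k {1..Suc s}) ` I) \<Longrightarrow>
         cbc M I (Suc s) (z(Suc s := c))"

end

theory Submission
  imports Defs
begin

text \<open>
  A continuous function in \<open>Hmix\<close> is the sum of its absolutely convergent Fourier series, so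
  the sampling error is \<open>\<Sum>\<^sub>h f\<^sub>h (e\<^sub>h - S e\<^sub>h)\<close>.  The terms with \<open>h\<close> in the hyperbolic cross \<open>H\<close>
  vanish by reconstruction.  Any other \<open>h\<close> is aliased to at most one frequency of \<open>H\<close>, so the
  error is at most \<open>2 \<Sum>\<^sub>h |f\<^sub>h|\<close> over \<open>h \<notin> H\<close>, and by Cauchy-Schwarz everything reduces to the
  tail of \<open>\<Prod>\<^sub>s (1 + |k\<^sub>s|\<^sup>2) powr - \<alpha>\<^sub>s\<close> outside \<open>H\<close>.  That tail is summed one coordinate at a time
  over dyadic blocks: the first \<open>\<mu>\<close> coordinates balance the decay \<open>2 powr - (2 \<alpha>\<^sub>1 - 1) R\<close> exactly and
  produce the power \<open>R ^ (\<mu> - 1)\<close>, the others give convergent geometric series because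
  \<open>(2 \<alpha>\<^sub>1 - 1) \<gamma>\<^sub>s / \<alpha>\<^sub>1 < 2 \<alpha>\<^sub>s - 1\<close>.  For the bound in terms of \<open>M\<close> one only needs
  \<open>M \<ge> |H| \<ge> 2 ^ nat \<lfloor>R\<rfloor>\<close>, hence \<open>ln M\<close> is at least of order \<open>R\<close>.
\<close>

section \<open>Characters of the torus\<close>

lemma trig_cis: "trig d k x = cis (2 * pi * dotp d k x)"
  by (simp add: trig_def cis_conv_exp mult_ac)

lemma exp_minus_dotp_eq: "exp (- 2 * of_real pi * \<i> * of_real (dotp d k x)) = cnj (trig d k x)"
  unfolding trig_cis cis_cnj by (simp add: cis_conv_exp mult_ac)

lemma norm_trig [simp]: "norm (trig d k x) = 1"
  by (simp add: trig_cis)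

lemma cnj_trig: "cnj (trig d k x) = trig d (\<lambda>s. - k s) x"
  by (simp add: trig_cis cis_cnj dotp_def sum_negf)

lemma trig_mult: "trig d k x * trig d l x = trig d (\<lambda>s. k s + l s) x"
  by (simp add: trig_cis cis_mult dotp_def sum.distrib algebra_simps)

lemma trig_cong: "(\<And>s. s \<in> {1..d} \<Longrightarrow> k s = l s) \<Longrightarrow> trig d k = trig d l"
  by (auto simp: fun_eq_iff trig_def dotp_def intro!: sum.cong arg_cong[where f = exp])

text \<open>The product form separates the variables, so that integrals over the torus reduce to one
  dimension.\<close>

lemma trig_prod: "trig d k x = (\<Prod>s\<in>{1..d}. cis (2 * pi * (of_int (k s) * x s)))"
proof -
  have "(\<Prod>s\<in>S. cis (2 * pi * (of_int (k s) * x s))) = cis (\<Sum>s\<in>S. 2 * pi * (of_int (k s) * x s))"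
    if "finite S" for S
    using that by induction (auto simp: cis_mult)
  thus ?thesis by (simp add: trig_cis dotp_def sum_distrib_left)
qed

lemma cis_periodic:
  assumes "a - b \<in> \<int>"
  shows "cis (2 * pi * a) = cis (2 * pi * b)"
proof -
  obtain n where n: "a - b = of_int n" using assms by (auto elim: Ints_cases)
  hence "2 * pi * a = 2 * pi * b + 2 * pi * of_int n" by (metis add.commute diff_eq_eq distrib_left)
  thus ?thesis by (simp add: cis_mult[symmetric])
qed

lemma torus_fun_trig: "torus_fun d (trig d k)"
  unfolding torus_fun_def trig_cis
proof (intro allI impI cis_periodic)
  fix x y :: "nat \<Rightarrow> real" assume *: "\<forall>s\<in>{1..d}. x s - y s \<in> \<int>"
  have "dotp d k x - dotp d k y = (\<Sum>s\<in>{1..d}. of_int (k s) * (x s - y s))"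
    by (simp add: dotp_def sum_subtractf algebra_simps)
  also have "\<dots> \<in> \<int>" using * by (intro Ints_sum Ints_mult) auto
  finally show "dotp d k x - dotp d k y \<in> \<int>" .
qed

lemma continuous_on_trig: "continuous_on UNIV (trig d k)"
  unfolding trig_def dotp_def by (intro continuous_intros continuous_on_product_coordinates)

section \<open>Lebesgue measure on the torus and orthogonality of the characters\<close>

abbreviation unit_lebesgue :: "real measure" where
  "unit_lebesgue \<equiv> restrict_space lborel {0..<1}"

lemma space_unit_lebesgue [simp]: "space unit_lebesgue = {0..<1}"
  by (simp add: space_restrict_space)

lemma prob_space_unit_lebesgue: "prob_space unit_lebesgue"
  by (rule prob_spaceI) (simp add: emeasure_restrict_space space_restrict_space)

lemma space_torus: "space (torus d) = ({1..d} \<rightarrow>\<^sub>E {0..<1})"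
  by (simp add: torus_def space_PiM)

lemma prob_space_torus: "prob_space (torus d)"
  unfolding torus_def by (intro prob_space_PiM prob_space_unit_lebesgue)

lemma measurable_torus_component [measurable]:
  assumes "s \<in> {1..d}"
  shows "(\<lambda>x. x s) \<in> borel_measurable (torus d)"
proof -
  have "(\<lambda>x. x s) \<in> measurable (torus d) unit_lebesgue"
    unfolding torus_def using assms by (intro measurable_component_singleton)
  moreover have "(\<lambda>x. x) \<in> borel_measurable unit_lebesgue"
    by (intro measurable_restrict_space1) simp
  ultimately show ?thesis using measurable_compose by blast
qed

lemma borel_measurable_trig [measurable]: "trig d k \<in> borel_measurable (torus d)"
proof -
  have "(\<lambda>x. dotp d k x) \<in> borel_measurable (torus d)"
    unfolding dotp_def by (intro borel_measurable_sum borel_measurable_times measurable_torus_component) auto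
  thus ?thesis unfolding trig_def by measurable
qed

text \<open>For \<open>n \<noteq> 0\<close> the antiderivative \<open>F\<close> is 1-periodic, so
  the fundamental theorem of calculus gives zero.\<close>

lemma integral_cis_unit_lebesgue:
  fixes n :: int
  shows "(LINT t|unit_lebesgue. cis (2 * pi * (of_int n * t))) = (if n = 0 then 1 else 0)"
proof (cases "n = 0")
  case True
  interpret prob_space unit_lebesgue by (rule prob_space_unit_lebesgue)
  show ?thesis using True prob_space by (simp add: space_restrict_space)
next
  case False
  define F where "F t = cis (2 * pi * (of_int n * t)) / (2 * pi * of_int n * \<i>)" for t
  have "(LINT t|unit_lebesgue. cis (2 * pi * (of_int n * t))) =
        (LINT t|lborel. indicator {0..<1} t *\<^sub>R cis (2 * pi * (of_int n * t)))"
    by (subst integral_restrict_space) auto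
  \<comment> \<open>The fundamental theorem is applied on a closed interval; adding the endpoint 1
    changes a null set only.\<close>
  also have "\<dots> = (LINT t|lborel. indicator {0..1} t *\<^sub>R cis (2 * pi * (of_int n * t)))"
  proof (rule integral_cong_AE)
    have "AE t in lborel. t \<noteq> (1::real)" by (rule AE_lborel_singleton)
    thus "AE t in lborel. indicator {0..<1} t *\<^sub>R cis (2 * pi * (of_int n * t)) =
            indicator {0..1} t *\<^sub>R cis (2 * pi * (of_int n * t))"
      by eventually_elim (auto split: split_indicator)
  qed (simp_all add: cis_conv_exp)
  also have "\<dots> = F 1 - F 0"
  proof (rule integral_FTC_Icc)
    show "(F has_vector_derivative cis (2 * pi * (of_int n * t))) (at t within {0..1})" for t
    proof -
      define c where "c = 2 * pi * of_int n * \<i>"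
      have "c \<noteq> 0" using False by (simp add: c_def)
      hence "((\<lambda>z. exp (c * z) / c) has_field_derivative exp (c * of_real t)) (at (of_real t))"
        by (auto intro!: derivative_eq_intros)
      from has_vector_derivative_real_field[OF this] show ?thesis
        by (simp add: F_def[abs_def] c_def cis_conv_exp mult_ac)
    qed
    show "continuous_on {0..1} (\<lambda>t. cis (2 * pi * (of_int n * t)))"
      by (intro continuous_intros)
  qed auto
  also have "F 1 = F 0"
    unfolding F_def using cis_multiple_2pi[of "of_int n"] by simp
  finally show ?thesis using False by simp
qed

lemma integral_trig: "(LINT x|torus d. trig d k x) = (if \<forall>s\<in>{1..d}. k s = 0 then 1 else 0)"
proof -
  interpret product_prob_space "\<lambda>_::nat. unit_lebesgue" "{1..d}"
    by (auto simp: product_prob_space_def product_sigma_finite_def product_prob_space_axioms_def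
          prob_space_unit_lebesgue prob_space_imp_sigma_finite)
  have "(LINT x|torus d. trig d k x) =
        (\<Prod>s\<in>{1..d}. LINT t|unit_lebesgue. cis (2 * pi * (of_int (k s) * t)))"
    unfolding torus_def trig_prod
  proof (rule product_integral_prod)
    fix s
    have "(\<lambda>t. cis (2 * pi * (of_int (k s) * t))) \<in> borel_measurable unit_lebesgue"
      by (intro measurable_restrict_space1) (simp add: cis_conv_exp)
    thus "integrable unit_lebesgue (\<lambda>t. cis (2 * pi * (of_int (k s) * t)))"
      by (intro finite_measure.integrable_const_bound[where B = 1]
            prob_space.finite_measure[OF prob_space_unit_lebesgue]) auto
  qed simp
  thus ?thesis by (simp only: integral_cis_unit_lebesgue) auto
qed

section \<open>Uniqueness of Fourier coefficients\<close>

text \<open>Neighbourhoods in the product topology on \<open>nat \<Rightarrow> real\<close> may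
  constrain any coordinate, but \<open>f\<close> sees only the first \<open>d\<close>. This reduces
  continuity to a cube in these coordinates.\<close>

lemma torus_fun_nhd:
  assumes "torus_fun d f" "continuous_on UNIV f" "open U" "f x0 \<in> U"
  obtains \<delta> where "\<delta> > 0" "\<And>y. (\<And>s. s \<in> {1..d} \<Longrightarrow> \<bar>y s - x0 s\<bar> < \<delta>) \<Longrightarrow> f y \<in> U"
proof -
  have "open (f -` U)" using assms by (simp add: open_vimage)
  hence "openin (product_topology (\<lambda>_. euclidean) UNIV) (f -` U)" by (simp add: open_fun_def)
  from product_topology_open_contains_basis[OF this, of x0] assms(4)
  obtain X where X: "x0 \<in> (\<Pi>\<^sub>E i\<in>UNIV. X i)" "\<And>i. open (X i)" "(\<Pi>\<^sub>E i\<in>UNIV. X i) \<subseteq> f -` U"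
    by auto
  have "\<exists>e>0. \<forall>t. \<bar>t - x0 s\<bar> < e \<longrightarrow> t \<in> X s" for s
  proof -
    have "x0 s \<in> X s" using X(1) by auto
    with X(2)[of s] show ?thesis by (auto simp: open_real)
  qed
  then obtain e where e: "\<And>s. e s > 0" "\<And>s t. \<bar>t - x0 s\<bar> < e s \<Longrightarrow> t \<in> X s" by metis
  \<comment> \<open>The inserted 1 keeps the set nonempty when \<open>d = 0\<close>.\<close>
  define \<delta> where "\<delta> = Min (insert 1 (e ` {1..d}))"
  show thesis
  proof
    show "\<delta> > 0" unfolding \<delta>_def using e(1) by (subst Min_gr_iff) auto
    fix y assume y: "\<And>s. s \<in> {1..d} \<Longrightarrow> \<bar>y s - x0 s\<bar> < \<delta>"
    \<comment> \<open>Coordinates beyond \<open>d\<close> are taken from \<open>x0\<close>, which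
      puts \<open>y'\<close> into the basic open set without changing the value of
      \<open>f\<close>.\<close>
    define y' where "y' s = (if s \<in> {1..d} then y s else x0 s)" for s
    have "\<delta> \<le> e s" if "s \<in> {1..d}" for s unfolding \<delta>_def using that by (intro Min_le) auto
    hence "y' s \<in> X s" for s
      using y[of s] e[of s] by (intro e(2)) (fastforce simp: y'_def)
    hence "f y' \<in> U" using X(3) by auto
    moreover have "f y = f y'"
      using assms(1) unfolding torus_fun_def by (auto simp: y'_def)
    ultimately show "f y \<in> U" by simp
  qed
qed

text \<open>After reduction modulo 1 the argument has modulus at most 1/2, and there the cosine
  decreases with the modulus.\<close>

lemma cos_gt_imp_near_int:
  fixes t \<delta> :: real
  assumes "0 < \<delta>" "\<delta> \<le> 1/2" "cos (2 * pi * \<delta>) < cos (2 * pi * t)"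
  shows "\<bar>t - of_int (round t)\<bar> < \<delta>"
proof (rule ccontr)
  define u where "u = t - of_int (round t)"
  assume "\<not> \<bar>t - of_int (round t)\<bar> < \<delta>"
  hence "\<delta> \<le> \<bar>u\<bar>" by (simp add: u_def)
  moreover have "\<bar>u\<bar> \<le> 1/2" using of_int_round_abs_le[of t] by (simp add: u_def abs_minus_commute)
  ultimately have "cos (2 * pi * \<bar>u\<bar>) \<le> cos (2 * pi * \<delta>)"
    using assms by (intro cos_monotone_0_pi_le) auto
  also have "cos (2 * pi * \<bar>u\<bar>) = cos (2 * pi * u)" by (cases "u \<ge> 0") auto
  also have "cis (2 * pi * u) = cis (2 * pi * t)" by (intro cis_periodic) (simp add: u_def)
  hence "cos (2 * pi * u) = cos (2 * pi * t)" by (metis cis.sel(1))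
  finally show False using assms by simp
qed

section \<open>Trigonometric bumps and functions with vanishing Fourier coefficients\<close>

text \<open>This is the square of cos(pi (t - a)): a trigonometric polynomial of degree 1 with
  values in [0,1] that equals 1 exactly on the integer translates of \<open>a\<close>.\<close>

definition cos_bump :: "real \<Rightarrow> real \<Rightarrow> real" where
  "cos_bump a t = (1 + cos (2 * pi * (t - a))) / 2"

lemma cos_bump_nonneg: "0 \<le> cos_bump a t"
proof -
  define c where "c = cos (2 * pi * (t - a))"
  have "- 1 \<le> c" unfolding c_def by (rule cos_ge_minus_one)
  thus ?thesis by (simp add: cos_bump_def c_def[symmetric])
qed

lemma cos_bump_le_1: "cos_bump a t \<le> 1"
  unfolding cos_bump_def by simp

text \<open>By Euler's formula the bump has frequencies -1, 0 and 1 in coordinate \<open>s\<close>,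
  so multiplying by it shifts \<open>k s\<close> by these amounts.\<close>

lemma cos_bump_trig:
  assumes "s \<in> {1..d}"
  shows "trig d k x * of_real (cos_bump a (x s)) = trig d k x / 2 +
           (cis (- (2 * pi * a)) / 4) * trig d (k(s := k s + 1)) x +
           (cis (2 * pi * a) / 4) * trig d (k(s := k s - 1)) x"
proof -
  have step: "trig d (k(s := k s + n)) x = trig d k x * cis (2 * pi * (of_int n * x s))" for n :: int
  proof -
    have "trig d (k(s := k s + n)) x = trig d (\<lambda>r. k r + (if r = s then n else 0)) x"
      by (intro fun_cong[OF trig_cong]) auto
    also have "\<dots> = trig d k x * trig d (\<lambda>r. if r = s then n else 0) x"
      by (simp add: trig_mult)
    also have "dotp d (\<lambda>r. if r = s then n else 0) x = (\<Sum>r\<in>{1..d}. if r = s then of_int n * x s else 0)"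
      unfolding dotp_def by (intro sum.cong) auto
    hence "trig d (\<lambda>r. if r = s then n else 0) x = cis (2 * pi * (of_int n * x s))"
      using assms by (simp add: trig_cis)
    finally show ?thesis .
  qed
  have "of_real (cos_bump a (x s)) =
          1 / 2 + cis (- (2 * pi * a)) / 4 * cis (2 * pi * x s) + cis (2 * pi * a) / 4 * cis (- (2 * pi * x s))"
    by (simp add: cos_bump_def complex_eq_iff cos_diff sin_diff field_simps)
  thus ?thesis using step[of 1] step[of "-1"] by (simp add: algebra_simps)
qed

text \<open>Pairing with \<open>trig d k\<close> rather than its conjugate is harmless, because
  \<open>k\<close> runs over all frequencies of either sign.\<close>

definition coeffs_vanish :: "nat \<Rightarrow> ((nat \<Rightarrow> real) \<Rightarrow> complex) \<Rightarrow> bool" where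
  "coeffs_vanish d h \<longleftrightarrow> integrable (torus d) h \<and> (\<forall>k. (LINT x|torus d. h x * trig d k x) = 0)"

lemma integrable_mult_bounded:
  fixes f g :: "'a \<Rightarrow> complex"
  assumes "integrable M f" "g \<in> borel_measurable M" "\<And>x. norm (g x) \<le> B"
  shows "integrable M (\<lambda>x. f x * g x)"
proof (rule Bochner_Integration.integrable_bound)
  show "integrable M (\<lambda>x. of_real B * f x)" using assms(1) by simp
  show "AE x in M. norm (f x * g x) \<le> norm (complex_of_real B * f x)"
  proof (rule AE_I2)
    fix x have "norm (g x) \<le> \<bar>B\<bar>" using assms(3)[of x] by simp
    thus "norm (f x * g x) \<le> norm (complex_of_real B * f x)"
      by (simp add: norm_mult mult.commute[of "\<bar>B\<bar>"] mult_left_mono)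
  qed
qed (use assms in measurable)

lemma integrable_mult_trig: "integrable (torus d) h \<Longrightarrow> integrable (torus d) (\<lambda>x. h x * trig d k x)"
  by (rule integrable_mult_bounded[where B = 1]) auto

lemma borel_measurable_cos_bump [measurable]:
  "s \<in> {1..d} \<Longrightarrow> (\<lambda>x. cos_bump a (x s)) \<in> borel_measurable (torus d)"
proof -
  assume "s \<in> {1..d}"
  note [measurable] = measurable_torus_component[OF this]
  show ?thesis unfolding cos_bump_def by measurable
qed

text \<open>Each coefficient of the product is a combination of three coefficients of
  \<open>h\<close>. Repetition extends this to products and powers of bumps.\<close>

lemma coeffs_vanish_mult_cos_bump:
  assumes "coeffs_vanish d h" "s \<in> {1..d}"
  shows "coeffs_vanish d (\<lambda>x. h x * of_real (cos_bump a (x s)))"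
  unfolding coeffs_vanish_def
proof (intro conjI allI)
  have h: "integrable (torus d) h" and z: "(LINT x|torus d. h x * trig d k x) = 0" for k
    using assms by (auto simp: coeffs_vanish_def)
  show "integrable (torus d) (\<lambda>x. h x * of_real (cos_bump a (x s)))"
    using h assms(2)
    by (intro integrable_mult_bounded[where B = 1] borel_measurable_of_real borel_measurable_cos_bump)
       (auto simp: cos_bump_nonneg cos_bump_le_1)
  fix k
  define c1 where "c1 = cis (- (2 * pi * a)) / 4"
  define c2 where "c2 = cis (2 * pi * a) / 4"
  have "h x * of_real (cos_bump a (x s)) * trig d k x =
          1 / 2 * (h x * trig d k x) + c1 * (h x * trig d (k(s := k s + 1)) x) +
          c2 * (h x * trig d (k(s := k s - 1)) x)" for x
  proof -
    have "h x * of_real (cos_bump a (x s)) * trig d k x = h x * (trig d k x * of_real (cos_bump a (x s)))"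
      by (simp add: mult_ac)
    thus ?thesis unfolding cos_bump_trig[OF assms(2)] by (simp add: c1_def c2_def algebra_simps)
  qed
  thus "(LINT x|torus d. h x * of_real (cos_bump a (x s)) * trig d k x) = 0"
    using z h by (simp add: integrable_mult_trig)
qed

definition bump :: "nat \<Rightarrow> (nat \<Rightarrow> real) \<Rightarrow> (nat \<Rightarrow> real) \<Rightarrow> real" where
  "bump d x0 x = (\<Prod>s\<in>{1..d}. cos_bump (x0 s) (x s))"

lemma bump_nonneg: "0 \<le> bump d x0 x"
  unfolding bump_def by (intro prod_nonneg cos_bump_nonneg)

text \<open>All other factors lie in [0,1]. Hence a lower bound on the product passes to each
  coordinate separately.\<close>

lemma bump_le_cos_bump:
  assumes "s \<in> {1..d}"
  shows "bump d x0 x \<le> cos_bump (x0 s) (x s)"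
proof -
  have "bump d x0 x = cos_bump (x0 s) (x s) * (\<Prod>r\<in>{1..d} - {s}. cos_bump (x0 r) (x r))"
    unfolding bump_def using assms by (intro prod.remove) auto
  also have "\<dots> \<le> cos_bump (x0 s) (x s) * 1"
    by (intro mult_left_mono prod_le_1) (auto simp: cos_bump_nonneg cos_bump_le_1)
  finally show ?thesis by simp
qed

lemma coeffs_vanish_mult_bump:
  assumes "coeffs_vanish d h"
  shows "coeffs_vanish d (\<lambda>x. h x * of_real (bump d x0 x))"
proof -
  have "coeffs_vanish d (\<lambda>x. h x * of_real (\<Prod>s\<in>S. cos_bump (x0 s) (x s)))"
    if "finite S" "S \<subseteq> {1..d}" for S
    using that
  proof (induction S)
    case (insert s S)
    hence "coeffs_vanish d (\<lambda>x. h x * of_real (\<Prod>s\<in>S. cos_bump (x0 s) (x s)) * of_real (cos_bump (x0 s) (x s)))"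
      by (intro coeffs_vanish_mult_cos_bump) auto
    thus ?case using insert by (simp add: mult_ac)
  qed (use assms in simp)
  thus ?thesis by (simp add: bump_def)
qed

lemma coeffs_vanish_mult_bump_power:
  assumes "coeffs_vanish d h"
  shows "coeffs_vanish d (\<lambda>x. h x * of_real (bump d x0 x ^ n))"
proof (induction n)
  case (Suc n)
  from coeffs_vanish_mult_bump[OF Suc, of x0] show ?case by (simp add: mult_ac)
qed (use assms in simp)

lemma torus_fun_bump: "torus_fun d (\<lambda>x. complex_of_real (bump d x0 x))"
proof -
  have "cos_bump (x0 s) (x s) = cos_bump (x0 s) (y s)" if "x s - y s \<in> \<int>" for x y :: "nat \<Rightarrow> real" and s
  proof -
    have "cis (2 * pi * (x s - x0 s)) = cis (2 * pi * (y s - x0 s))"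
      using that by (intro cis_periodic) simp
    thus ?thesis by (metis cis.sel(1) cos_bump_def)
  qed
  thus ?thesis unfolding torus_fun_def bump_def by (auto intro!: prod.cong)
qed

lemma continuous_on_bump: "continuous_on UNIV (\<lambda>x. complex_of_real (bump d x0 x))"
  unfolding bump_def cos_bump_def by (intro continuous_intros continuous_on_product_coordinates) auto

text \<open>The box extends from \<open>x0\<close> to larger coordinates only and is cut off at 1.
  It thus stays in the fundamental domain, and its sides are positive because
  \<open>x0 s < 1\<close>.\<close>

lemma measure_torus_box_pos:
  assumes "x0 \<in> space (torus d)" "\<delta> > 0"
  defines "A \<equiv> (\<Pi>\<^sub>E s\<in>{1..d}. {x0 s..<min 1 (x0 s + \<delta>)})"
  shows "A \<in> sets (torus d)" "measure (torus d) A > 0"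
proof -
  interpret product_prob_space "\<lambda>_::nat. unit_lebesgue" "{1..d}"
    by (auto simp: product_prob_space_def product_sigma_finite_def product_prob_space_axioms_def
          prob_space_unit_lebesgue prob_space_imp_sigma_finite)
  have x0: "0 \<le> x0 s" "x0 s < 1" if "s \<in> {1..d}" for s
    using assms(1) that by (auto simp: space_torus PiE_iff)
  have sets: "{x0 s..<min 1 (x0 s + \<delta>)} \<in> sets unit_lebesgue" if "s \<in> {1..d}" for s
    using x0[OF that] by (subst sets_restrict_space_iff) auto
  show "A \<in> sets (torus d)" unfolding A_def torus_def using sets by (intro sets_PiM_I_finite) auto
  have "emeasure (torus d) A = (\<Prod>s\<in>{1..d}. emeasure unit_lebesgue {x0 s..<min 1 (x0 s + \<delta>)})"
    unfolding A_def torus_def using sets by (intro emeasure_PiM) auto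
  also have "\<dots> = (\<Prod>s\<in>{1..d}. ennreal (min 1 (x0 s + \<delta>) - x0 s))"
  proof (rule prod.cong[OF refl])
    fix s assume "s \<in> {1..d}"
    note x0[OF this]
    moreover from this have "{x0 s..<min 1 (x0 s + \<delta>)} \<inter> {0..<1} = {x0 s..<min 1 (x0 s + \<delta>)}" by auto
    ultimately show "emeasure unit_lebesgue {x0 s..<min 1 (x0 s + \<delta>)} = ennreal (min 1 (x0 s + \<delta>) - x0 s)"
      using assms(2) by (subst emeasure_restrict_space) auto
  qed
  also have "\<dots> \<noteq> 0" using x0 assms(2) by (force simp: ennreal_eq_0_iff)
  finally show "measure (torus d) A > 0"
    using prob_space.finite_measure[OF prob_space_torus, of d]
    by (metis ennreal_0 finite_measure.emeasure_eq_measure less_eq_real_def measure_nonneg)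
qed

text \<open>
  If \<open>h x \<noteq> 0\<close>, the powers of a trigonometric bump centred at \<open>x\<close> concentrate where
  \<open>Re (cnj (h x) * h y)\<close> is bounded below, so their integrals against \<open>h\<close> cannot all vanish.
\<close>

theorem coeffs_vanish_imp_zero:
  assumes h: "torus_fun d h" "continuous_on UNIV h" "coeffs_vanish d h"
  shows "h x = 0"
proof (rule ccontr)
  assume nz: "h x \<noteq> 0"
  interpret T: prob_space "torus d" by (rule prob_space_torus)
  \<comment> \<open>The representative of \<open>x\<close> in the cube that carries the
    measure.\<close>
  define x0 where "x0 = (\<lambda>s\<in>{1..d}. frac (x s))"
  have x0_space: "x0 \<in> space (torus d)" by (auto simp: space_torus x0_def frac_lt_1)
  have "h x0 = h x" using h(1) unfolding torus_fun_def by (auto simp: x0_def frac_def)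
  \<comment> \<open>At \<open>x0\<close> this equals the squared modulus of \<open>h x\<close>,
    which is twice \<open>\<eta>\<close>.\<close>
  define u where "u y = Re (cnj (h x) * h y)" for y
  define \<eta> where "\<eta> = (norm (h x))\<^sup>2 / 2"
  have \<eta>: "\<eta> > 0" using nz by (simp add: \<eta>_def)
  have "h x0 \<in> {w. Re (cnj (h x) * w) > \<eta>}"
  proof -
    have "Re (cnj (h x) * h x) = (norm (h x))\<^sup>2" by (subst cmod_power2) (simp add: power2_eq_square)
    hence "\<eta> < Re (cnj (h x) * h x)" using \<eta> unfolding \<eta>_def by linarith
    thus ?thesis by (simp only: mem_Collect_eq \<open>h x0 = h x\<close>)
  qed
  moreover have "open {w. Re (cnj (h x) * w) > \<eta>}"
    by (intro open_Collect_less continuous_intros)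
  ultimately obtain \<delta>0 where \<delta>0: "\<delta>0 > 0" "\<And>y. (\<And>s. s \<in> {1..d} \<Longrightarrow> \<bar>y s - x0 s\<bar> < \<delta>0) \<Longrightarrow> u y > \<eta>"
    using torus_fun_nhd[OF h(1,2)] unfolding u_def by (metis (no_types, lifting) mem_Collect_eq)
  \<comment> \<open>The cap 1/4 keeps \<open>cos (2 * pi * \<delta>)\<close> nonnegative, hence
    \<open>q\<close> positive, so that division by \<open>q\<close> is possible later.\<close>
  define \<delta> where "\<delta> = min \<delta>0 (1/4)"
  have \<delta>: "0 < \<delta>" "\<delta> \<le> 1/4" "\<delta> \<le> \<delta>0" using \<delta>0 by (auto simp: \<delta>_def)
  define q where "q = cos_bump 0 \<delta>"
  have "cos (2 * pi * \<delta>) < cos 0" using \<delta> by (intro cos_monotone_0_pi) auto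
  hence q1: "q < 1" by (simp add: q_def cos_bump_def)
  have "0 \<le> 2 * pi * \<delta>" "2 * pi * \<delta> \<le> pi / 2" using \<delta> by auto
  hence "0 \<le> cos (2 * pi * \<delta>)" using pi_ge_zero by (intro cos_ge_zero) linarith+
  hence q0: "0 < q" by (simp add: q_def cos_bump_def)
  \<comment> \<open>A bump value above \<open>q\<close> forces every factor above \<open>q\<close>,
    hence every coordinate within \<open>\<delta>\<close> of \<open>x0\<close> modulo 1, where
    \<open>u\<close> exceeds \<open>\<eta>\<close>.\<close>
  have far: "bump d x0 y \<le> q" if "u y \<le> \<eta>" for y
  proof (rule ccontr)
    assume *: "\<not> bump d x0 y \<le> q"
    define y' where "y' s = y s - of_int (round (y s - x0 s))" for s
    have "u y' > \<eta>"
    proof (rule \<delta>0(2))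
      fix s assume s: "s \<in> {1..d}"
      have "q < cos_bump (x0 s) (y s)" using * bump_le_cos_bump[OF s, of x0 y] by simp
      hence "cos (2 * pi * \<delta>) < cos (2 * pi * (y s - x0 s))" by (simp add: q_def cos_bump_def)
      from cos_gt_imp_near_int[OF _ _ this] \<delta> show "\<bar>y' s - x0 s\<bar> < \<delta>0"
        by (simp add: y'_def algebra_simps)
    qed
    moreover have "h y' = h y" using h(1) unfolding torus_fun_def by (auto simp: y'_def)
    ultimately show False using that by (simp add: u_def)
  qed
  \<comment> \<open>Any value strictly between \<open>q\<close> and 1 would do: the bump exceeds
    \<open>r\<close> near \<open>x0\<close> and is at most \<open>q\<close> wherever
    \<open>u\<close> is not above \<open>\<eta>\<close>.\<close>
  define r where "r = (1 + q) / 2"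
  have r: "q < r" "r < 1" "0 < r" using q0 q1 by (auto simp: r_def)
  have "complex_of_real (bump d x0 x0) \<in> {w. Re w > r}" using r by (simp add: bump_def cos_bump_def)
  moreover have "open {w. Re w > r}" by (intro open_Collect_less continuous_intros)
  ultimately obtain \<delta>1 where \<delta>1: "\<delta>1 > 0"
    "\<And>y. (\<And>s. s \<in> {1..d} \<Longrightarrow> \<bar>y s - x0 s\<bar> < \<delta>1) \<Longrightarrow> bump d x0 y > r"
    using torus_fun_nhd[OF torus_fun_bump[of d x0] continuous_on_bump[of d x0]]
    by (metis (no_types, lifting) mem_Collect_eq Re_complex_of_real)
  define \<rho> where "\<rho> = min \<delta>0 \<delta>1"
  have \<rho>: "\<rho> > 0" using \<delta>0 \<delta>1 by (simp add: \<rho>_def)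
  define A where "A = (\<Pi>\<^sub>E s\<in>{1..d}. {x0 s..<min 1 (x0 s + \<rho>)})"
  note Am = measure_torus_box_pos[OF x0_space \<rho>, folded A_def]
  have inA: "u y > \<eta> \<and> bump d x0 y > r" if "y \<in> A" for y
  proof -
    have "\<bar>y s - x0 s\<bar> < \<rho>" if "s \<in> {1..d}" for s
    proof -
      have "y s \<in> {x0 s..<min 1 (x0 s + \<rho>)}" using \<open>y \<in> A\<close> that unfolding A_def by (rule PiE_mem)
      thus ?thesis by auto
    qed
    thus ?thesis using \<delta>0(2)[of y] \<delta>1(2)[of y] by (auto simp: \<rho>_def)
  qed
  have h_int: "integrable (torus d) h" using h(3) by (simp add: coeffs_vanish_def)
  have u_int: "integrable (torus d) u" unfolding u_def[abs_def] using h_int by (intro integrable_Re integrable_mult_right)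
  define L where "L = (LINT y|torus d. \<bar>u y\<bar>)"
  \<comment> \<open>The integral of \<open>u\<close> against each power of the bump is zero, so the
    gain on \<open>A\<close>, of order \<open>r ^ n\<close>, is bounded by the loss elsewhere, of
    order \<open>q ^ n\<close>. This fails for large \<open>n\<close>.\<close>
  have "\<eta> * measure (torus d) A * (r / q) ^ n \<le> L" for n
  proof -
    have vn: "coeffs_vanish d (\<lambda>y. h y * of_real (bump d x0 y ^ n))"
      by (rule coeffs_vanish_mult_bump_power[OF h(3)])
    hence int: "integrable (torus d) (\<lambda>y. h y * of_real (bump d x0 y ^ n))"
      and "(LINT y|torus d. h y * of_real (bump d x0 y ^ n) * trig d (\<lambda>_. 0) y) = 0"
      by (auto simp: coeffs_vanish_def)
    hence z: "(LINT y|torus d. h y * of_real (bump d x0 y ^ n)) = 0"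
      by (simp add: trig_def dotp_def)
    have ub: "u y * bump d x0 y ^ n = Re (cnj (h x) * (h y * of_real (bump d x0 y ^ n)))" for y
    proof -
      have "cnj (h x) * (h y * of_real (bump d x0 y ^ n)) = of_real (bump d x0 y ^ n) * (cnj (h x) * h y)"
        by (simp add: mult_ac)
      thus ?thesis by (simp add: u_def algebra_simps del: of_real_power)
    qed
    have "(LINT y|torus d. u y * bump d x0 y ^ n) = Re (cnj (h x) * 0)"
      unfolding ub z[symmetric] using int by (subst integral_Re) (auto simp del: of_real_power)
    hence z': "(LINT y|torus d. u y * bump d x0 y ^ n) = 0" by simp
    have int': "integrable (torus d) (\<lambda>y. u y * bump d x0 y ^ n)"
      unfolding ub using int by (intro integrable_Re integrable_mult_right)
    \<comment> \<open>Three regions: where \<open>u \<le> \<eta>\<close> the product is at least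
      \<open>- q ^ n * \<bar>u y\<bar>\<close>, on \<open>A\<close> it is at least
      \<open>\<eta> * r ^ n\<close>, and elsewhere it is nonnegative.\<close>
    have low: "\<eta> * r ^ n * indicator A y - q ^ n * \<bar>u y\<bar> \<le> u y * bump d x0 y ^ n" for y
    proof (cases "u y \<le> \<eta>")
      case True
      hence "bump d x0 y ^ n \<le> q ^ n" using far bump_nonneg by (intro power_mono) auto
      hence "\<bar>u y\<bar> * bump d x0 y ^ n \<le> \<bar>u y\<bar> * q ^ n" by (intro mult_left_mono) auto
      moreover have "- \<bar>u y\<bar> * bump d x0 y ^ n \<le> u y * bump d x0 y ^ n"
        by (intro mult_right_mono) (auto simp: bump_nonneg)
      moreover have "y \<notin> A" using True inA by force
      ultimately show ?thesis by (simp add: mult.commute)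
    next
      case False
      have nn: "0 \<le> q ^ n * \<bar>u y\<bar>" using q0 by simp
      show ?thesis
      proof (cases "y \<in> A")
        case True
        have "\<eta> * r ^ n \<le> u y * bump d x0 y ^ n"
          using inA[OF True] \<eta> r by (intro mult_mono power_mono) auto
        thus ?thesis using True nn by simp
      next
        case A: False
        have "0 \<le> u y * bump d x0 y ^ n" using False \<eta> bump_nonneg by (intro mult_nonneg_nonneg) auto
        thus ?thesis using A nn by simp
      qed
    qed
    have Aint: "integrable (torus d) (indicator A :: _ \<Rightarrow> real)" using Am(1)
      by (intro integrable_real_indicator) (auto simp: T.emeasure_eq_measure)
    have "\<eta> * r ^ n * measure (torus d) A - q ^ n * L =
            (LINT y|torus d. \<eta> * r ^ n * indicator A y - q ^ n * \<bar>u y\<bar>)"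
      using Aint u_int Am(1) sets.sets_into_space[OF Am(1)] by (simp add: L_def Int_absorb2)
    also have "\<dots> \<le> (LINT y|torus d. u y * bump d x0 y ^ n)"
      using Aint u_int int' low by (intro integral_mono) auto
    finally have "\<eta> * r ^ n * measure (torus d) A \<le> q ^ n * L" by (simp add: z')
    thus ?thesis using q0 by (simp add: power_divide field_simps)
  qed
  moreover obtain n where "L / (\<eta> * measure (torus d) A) < (r / q) ^ n"
    using real_arch_pow[of "r / q"] r q0 by auto
  hence "L < \<eta> * measure (torus d) A * (r / q) ^ n" using \<eta> Am(2) by (simp add: field_simps)
  ultimately show False by (meson not_le)
qed

section \<open>Fourier series with absolutely summable coefficients\<close>

lemma fourier_coeff_trig: "fourier_coeff d f k = (LINT x|torus d. f x * trig d (\<lambda>s. - k s) x)"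
  by (simp only: fourier_coeff_def exp_minus_dotp_eq cnj_trig)

lemma fourier_coeff_restrict: "fourier_coeff d f (restrict k {1..d}) = fourier_coeff d f k"
proof -
  have "trig d (\<lambda>s. - restrict k {1..d} s) = trig d (\<lambda>s. - k s)" by (intro trig_cong) simp
  thus ?thesis by (simp add: fourier_coeff_trig)
qed

text \<open>Since t <= 1 + t^2, square integrability implies integrability on a probability
  space.\<close>

lemma L2_torus_integrable:
  assumes "f \<in> L2_torus d"
  shows "integrable (torus d) f"
proof -
  interpret prob_space "torus d" by (rule prob_space_torus)
  have f: "f \<in> borel_measurable (torus d)" "integrable (torus d) (\<lambda>x. (cmod (f x))\<^sup>2)"
    using assms by (auto simp: L2_torus_def)
  show ?thesis
  proof (rule Bochner_Integration.integrable_bound)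
    show "integrable (torus d) (\<lambda>x. 1 + (cmod (f x))\<^sup>2)" using f(2) by simp
    show "AE x in torus d. norm (f x) \<le> norm (1 + (cmod (f x))\<^sup>2)"
    proof (rule AE_I2)
      fix x
      have "0 \<le> (cmod (f x) - 1)\<^sup>2 + (cmod (f x))\<^sup>2 + 1" by simp
      hence "cmod (f x) \<le> 1 + (cmod (f x))\<^sup>2" by (simp add: power2_diff)
      thus "norm (f x) \<le> norm (1 + (cmod (f x))\<^sup>2)" by simp
    qed
  qed (use f in simp)
qed

lemma countable_freqs: "countable (freqs d)"
  unfolding freqs_def by (intro countable_PiE) auto

text \<open>The constant frequencies already form an infinite family. Together with countability
  this permits a bijective enumeration by the naturals.\<close>

lemma infinite_freqs:
  assumes "d \<ge> 1"
  shows "infinite (freqs d)"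
proof
  assume fin: "finite (freqs d)"
  have "inj (\<lambda>n::int. restrict (\<lambda>_. n) {1..d})"
    using assms by (intro injI) (metis restrict_apply' atLeastAtMost_iff order_refl)
  moreover have "range (\<lambda>n::int. restrict (\<lambda>_. n) {1..d}) \<subseteq> freqs d" by (auto simp: freqs_def)
  ultimately have "finite (UNIV :: int set)" using fin by (meson finite_subset finite_imageD)
  thus False by simp
qed

text \<open>The series converges uniformly to a continuous \<open>g\<close> whose coefficients are
  those of \<open>f\<close>; uniqueness applied to \<open>f - g\<close> gives equality at every
  point, not just almost everywhere.\<close>

theorem fourier_series_has_sum:
  assumes "d \<ge> 1" "f \<in> L2_torus d" "continuous_on UNIV f"
    and abs: "(\<lambda>k. cmod (fourier_coeff d f k)) summable_on freqs d"
  shows "((\<lambda>k. fourier_coeff d f k * trig d k x) has_sum f x) (freqs d)"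
proof -
  \<comment> \<open>An enumeration turns the unordered sum into an ordinary series, for the
    Weierstrass test and termwise integration.\<close>
  define e where "e = from_nat_into (freqs d)"
  have e: "bij_betw e UNIV (freqs d)"
    unfolding e_def by (intro bij_betw_from_nat_into countable_freqs infinite_freqs assms)
  define c where "c n = fourier_coeff d f (e n)" for n
  have "(\<lambda>n. cmod (c n)) summable_on UNIV"
    using summable_on_reindex_bij_betw[OF e, of "\<lambda>k. cmod (fourier_coeff d f k)"] abs by (simp add: c_def)
  hence c_sum: "summable (\<lambda>n. cmod (c n))" by (simp add: summable_on_UNIV_nonneg_real_iff)
  define g where "g y = (\<Sum>n. c n * trig d (e n) y)" for y
  have g_abs: "summable (\<lambda>n. norm (c n * trig d (e n) y))" for y
    using c_sum by (simp add: norm_mult)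
  have g_sum0: "((\<lambda>n. c n * trig d (e n) y) has_sum g y) UNIV" for y
    by (rule norm_summable_imp_has_sum[OF g_abs]) (simp add: g_def summable_norm_cancel[OF g_abs] summable_sums)
  hence g_sum: "((\<lambda>k. fourier_coeff d f k * trig d k y) has_sum g y) (freqs d)" for y
    using has_sum_reindex_bij_betw[OF e, of "\<lambda>k. fourier_coeff d f k * trig d k y"] g_sum0[of y]
    by (simp add: c_def)
  have g_cont: "continuous_on UNIV g"
  proof (rule uniform_limit_theorem)
    show "uniform_limit UNIV (\<lambda>N y. \<Sum>n<N. c n * trig d (e n) y) g sequentially"
      unfolding g_def[abs_def] by (rule Weierstrass_m_test[OF _ c_sum]) (simp add: norm_mult)
    show "\<forall>\<^sub>F N in sequentially. continuous_on UNIV (\<lambda>y. \<Sum>n<N. c n * trig d (e n) y)"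
      by (intro always_eventually allI continuous_intros continuous_on_trig)
  qed simp
  interpret T: prob_space "torus d" by (rule prob_space_torus)
  have trig_int: "integrable (torus d) (trig d k)" for k
    by (rule T.integrable_const_bound[where B = 1]) auto
  \<comment> \<open>Termwise integration keeps only the frequency opposite to \<open>k\<close>, by
    orthogonality.\<close>
  have g_tr: "integrable (torus d) (\<lambda>y. g y * trig d k y) \<and>
              (LINT y|torus d. g y * trig d k y) = fourier_coeff d f (\<lambda>s. - k s)" for k
  proof -
    define w where "w n y = c n * trig d (\<lambda>s. e n s + k s) y" for n y
    have gw: "g y * trig d k y = (\<Sum>n. w n y)" for y
      unfolding g_def w_def
      by (subst suminf_mult2[OF summable_norm_cancel[OF g_abs]]) (simp add: mult.assoc trig_mult)
    have w_int: "integrable (torus d) (w n)" for n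
      unfolding w_def by (intro integrable_mult_right trig_int)
    have w_norm: "norm (w n y) = cmod (c n)" for n y by (simp add: w_def norm_mult)
    have ws: "summable (\<lambda>n. LINT y|torus d. norm (w n y))"
      using c_sum by (simp add: w_norm T.prob_space)
    have aes: "AE y in torus d. summable (\<lambda>n. norm (w n y))" using c_sum by (simp add: w_norm)
    have "(LINT y|torus d. (\<Sum>n. w n y)) = (\<Sum>n. LINT y|torus d. w n y)"
      by (rule integral_suminf[OF w_int aes ws])
    also have "\<dots> = fourier_coeff d f (\<lambda>s. - k s)"
    proof -
      \<comment> \<open>Members of \<open>freqs d\<close> are \<open>undefined\<close> outside
        \<open>{1..d}\<close>, so the negated frequency must be cut down before it can be found in
        the enumeration.\<close>
      define l where "l = restrict (\<lambda>s. - k s) {1..d}"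
      have "l \<in> freqs d" by (auto simp: l_def freqs_def)
      then obtain m where m: "e m = l" using e by (metis bij_betw_imp_surj_on rangeE)
      have "(LINT y|torus d. w n y) = (if n = m then fourier_coeff d f l else 0)" for n
      proof -
        have "(\<forall>s\<in>{1..d}. e n s + k s = 0) \<longleftrightarrow> e n = l"
        proof
          assume *: "\<forall>s\<in>{1..d}. e n s + k s = 0"
          have "e n \<in> freqs d" using e by (auto simp: bij_betw_def)
          thus "e n = l" using * unfolding freqs_def l_def
            by (intro PiE_ext[of _ "{1..d}" "\<lambda>_. UNIV"]) (auto simp: eq_neg_iff_add_eq_0)
        qed (auto simp: l_def)
        also have "\<dots> \<longleftrightarrow> n = m" using e m by (metis bij_betw_imp_inj_on injD)
        finally show ?thesis unfolding w_def using m by (auto simp: integral_trig c_def)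
      qed
      thus ?thesis using sums_single[of m "\<lambda>_. fourier_coeff d f l"]
        by (simp add: sums_iff l_def fourier_coeff_restrict[unfolded One_nat_def])
    qed
    finally show ?thesis using integrable_suminf[OF w_int aes ws] by (simp add: gw)
  qed
  have f_int: "integrable (torus d) f" by (rule L2_torus_integrable[OF assms(2)])
  have "f x - g x = 0"
  proof (rule coeffs_vanish_imp_zero[where d = d])
    have "g y = g z" if "\<forall>s\<in>{1..d}. y s - z s \<in> \<int>" for y z
    proof -
      have "trig d k y = trig d k z" for k using torus_fun_trig[of d k] that unfolding torus_fun_def by blast
      thus ?thesis by (simp add: g_def)
    qed
    moreover have "torus_fun d f" using assms(2) by (simp add: L2_torus_def)
    ultimately show "torus_fun d (\<lambda>y. f y - g y)" unfolding torus_fun_def by metis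
    show "continuous_on UNIV (\<lambda>y. f y - g y)" using assms(3) g_cont by (intro continuous_intros)
    have g_int: "integrable (torus d) g" using g_tr[of "\<lambda>_. 0"] by (simp add: trig_def dotp_def)
    have "(LINT y|torus d. (f y - g y) * trig d k y) = 0" for k
    proof -
      have "(LINT y|torus d. (f y - g y) * trig d k y) =
            (LINT y|torus d. f y * trig d k y) - (LINT y|torus d. g y * trig d k y)"
        using g_tr[of k] integrable_mult_trig[OF f_int, of k]
        by (simp add: left_diff_distrib)
      thus ?thesis using g_tr[of k] by (simp add: fourier_coeff_trig)
    qed
    thus "coeffs_vanish d (\<lambda>y. f y - g y)" using f_int g_int by (simp add: coeffs_vanish_def)
  qed
  thus ?thesis using g_sum[of x] by simp
qed

section \<open>Aliasing on reconstructing lattices\<close>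

definition int_dotp :: "nat \<Rightarrow> (nat \<Rightarrow> int) \<Rightarrow> (nat \<Rightarrow> int) \<Rightarrow> int" where
  "int_dotp d k z = (\<Sum>s\<in>{1..d}. k s * z s)"

text \<open>A geometric sum whose ratio \<open>w\<close> satisfies \<open>w ^ M = 1\<close>; it
  vanishes unless \<open>w = 1\<close>, which means that \<open>M\<close> divides
  \<open>n\<close>.\<close>

lemma sum_cis_roots_of_unity:
  fixes n :: int
  assumes "M > 0"
  shows "(\<Sum>j<M. cis (2 * pi * (of_int n * (real j / real M)))) = (if int M dvd n then of_nat M else 0)"
proof -
  define w where "w = cis (2 * pi * (of_int n / real M))"
  have wj: "cis (2 * pi * (of_int n * (real j / real M))) = w ^ j" for j
    unfolding w_def Complex.DeMoivre by (simp add: mult_ac)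
  have one: "w = 1 \<longleftrightarrow> int M dvd n"
  proof
    assume "int M dvd n"
    then obtain m where "n = int M * m" ..
    hence "of_int n / real M = of_int m" using assms by simp
    thus "w = 1" by (simp add: w_def)
  next
    assume "w = 1"
    hence "exp (\<i> * of_real (2 * pi * (of_int n / real M))) = 1" by (simp add: w_def cis_conv_exp)
    then obtain m :: int where "2 * pi * (of_int n / real M) = of_int (2 * m) * pi"
      by (auto simp: exp_eq_1)
    hence "of_int n = real M * of_int m" using assms by (simp add: field_simps)
    hence "n = int M * m" by (metis of_int_eq_iff of_int_mult of_int_of_nat_eq)
    thus "int M dvd n" by simp
  qed
  have "real M * (2 * pi * (of_int n / real M)) = 2 * pi * of_int n" using assms by simp
  hence "w ^ M = 1" unfolding w_def Complex.DeMoivre by simp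
  thus ?thesis unfolding wj using one sum_gp_strict[of w M] by simp
qed

lemma dotp_lattice_node: "dotp d k (lattice_node z M j) = real j / real M * of_int (int_dotp d k z)"
  by (simp add: dotp_def lattice_node_def int_dotp_def sum_distrib_left mult_ac)

lemma lattice_coeff_alt:
  "lattice_coeff d z M f k = 1 / of_nat M * (\<Sum>j<M. f (lattice_node z M j) * cnj (trig d k (lattice_node z M j)))"
  by (simp only: lattice_coeff_def exp_minus_dotp_eq)

text \<open>The nodes are multiples of \<open>z / M\<close>, so the lattice sees a frequency only
  through its inner product with \<open>z\<close> modulo \<open>M\<close>.\<close>

lemma lattice_coeff_trig:
  assumes "M > 0"
  shows "lattice_coeff d z M (trig d h) k = (if int M dvd int_dotp d h z - int_dotp d k z then 1 else 0)"
proof -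
  have "trig d h (lattice_node z M j) * cnj (trig d k (lattice_node z M j)) =
        cis (2 * pi * (of_int (int_dotp d h z - int_dotp d k z) * (real j / real M)))" for j
    by (simp add: trig_cis cis_cnj cis_mult dotp_lattice_node algebra_simps)
  hence "lattice_coeff d z M (trig d h) k =
           1 / of_nat M * (if int M dvd int_dotp d h z - int_dotp d k z then of_nat M else 0)"
    unfolding lattice_coeff_alt by (simp only: sum_cis_roots_of_unity[OF assms])
  thus ?thesis using assms by simp
qed

lemma lattice_sampling_trig:
  assumes "M > 0" "finite I"
  shows "lattice_sampling d z M I (trig d h) x =
           (\<Sum>k \<in> {k\<in>I. int M dvd int_dotp d h z - int_dotp d k z}. trig d k x)"
  unfolding lattice_sampling_def lattice_coeff_trig[OF assms(1)]
  using assms(2) by (simp add: sum.inter_filter if_distrib[where f = "\<lambda>c. c * _"] cong: if_cong)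

lemma reconstructing_trig:
  assumes "reconstructing d z M I" "finite I" "k \<in> I"
  shows "lattice_sampling d z M I (trig d k) = trig d k"
proof -
  have "trig d k x = (\<Sum>l\<in>I. (if l = k then 1 else 0) * trig d l x)" for x
    using assms(2,3) by (simp add: if_distrib[where f = "\<lambda>c. c * _"] cong: if_cong)
  hence "trig d k = (\<lambda>x. \<Sum>l\<in>I. (if l = k then 1 else 0) * trig d l x)" by (rule ext)
  hence "trig d k \<in> trig_polys d I"
    unfolding trig_polys_def mem_Collect_eq by (rule exI[of _ "\<lambda>l. if l = k then 1 else 0"])
  thus ?thesis using assms(1) by (simp add: reconstructing_def)
qed

text \<open>For \<open>M = 0\<close> every lattice coefficient is an empty sum, so sampling yields
  zero and cannot reproduce a character of modulus 1.\<close>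

lemma reconstructing_size_pos:
  assumes "reconstructing d z M I" "finite I" "k \<in> I"
  shows "M > 0"
proof (rule ccontr)
  assume "\<not> M > 0"
  hence "lattice_sampling d z M I (trig d k) (\<lambda>_. 0) = 0"
    by (simp add: lattice_sampling_def lattice_coeff_def)
  thus False using reconstructing_trig[OF assms] norm_trig[of d k "\<lambda>_. 0"] by simp
qed

text \<open>Evaluating \<open>S e\<^sub>k = e\<^sub>k\<close> at the origin counts the aliases of \<open>k\<close> in \<open>I\<close>.\<close>

lemma reconstructing_no_alias:
  assumes "reconstructing d z M I" "finite I" "k \<in> I" "l \<in> I"
    and "int M dvd int_dotp d k z - int_dotp d l z"
  shows "k = l"
proof -
  define A where "A = {l\<in>I. int M dvd int_dotp d k z - int_dotp d l z}"
  have "M > 0" using assms by (blast intro: reconstructing_size_pos)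
  from lattice_sampling_trig[OF this assms(2), of d z k "\<lambda>_. 0"]
  have "(\<Sum>l\<in>A. trig d l (\<lambda>_. 0)) = trig d k (\<lambda>_. 0)"
    by (simp add: reconstructing_trig[OF assms(1,2,3)] A_def)
  hence "of_nat (card A) = (1::complex)" by (simp add: trig_def dotp_def)
  hence "card A = 1" by (metis of_nat_1 of_nat_eq_iff)
  moreover have "k \<in> A" "l \<in> A" using assms by (auto simp: A_def)
  ultimately show ?thesis by (metis card_1_singletonE singletonD)
qed

text \<open>Distinct frequencies of \<open>I\<close> have distinct residues modulo
  \<open>M\<close>.\<close>

lemma reconstructing_card_le:
  assumes "reconstructing d z M I" "finite I" "I \<noteq> {}"
  shows "card I \<le> M"
proof -
  have M: "M > 0" using assms by (blast intro: reconstructing_size_pos)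
  have "inj_on (\<lambda>k. int_dotp d k z mod int M) I"
    using reconstructing_no_alias[OF assms(1,2)] by (intro inj_onI) (simp add: mod_eq_dvd_iff)
  hence "card I \<le> card {0..<int M}" by (rule card_inj_on_le) (use M in auto)
  thus ?thesis by simp
qed

text \<open>Two aliases of \<open>h\<close> in \<open>I\<close> would be aliases of each other, so
  at most one character survives the sampling.\<close>

lemma norm_lattice_sampling_trig_le:
  assumes "reconstructing d z M I" "finite I" "I \<noteq> {}"
  shows "norm (lattice_sampling d z M I (trig d h) x) \<le> 1"
proof -
  define A where "A = {k\<in>I. int M dvd int_dotp d h z - int_dotp d k z}"
  have M: "M > 0" using assms by (blast intro: reconstructing_size_pos)
  have "k = l" if "k \<in> A" "l \<in> A" for k l
  proof (rule reconstructing_no_alias[OF assms(1,2)])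
    show "k \<in> I" "l \<in> I" using that by (auto simp: A_def)
    have "int M dvd (int_dotp d h z - int_dotp d l z) - (int_dotp d h z - int_dotp d k z)"
      using that unfolding A_def by (blast intro: dvd_diff)
    thus "int M dvd int_dotp d k z - int_dotp d l z" by simp
  qed
  hence "card A \<le> 1" using assms(2) by (auto simp: card_le_Suc0_iff_eq A_def)
  have "norm (lattice_sampling d z M I (trig d h) x) \<le> (\<Sum>k\<in>A. norm (trig d k x))"
    unfolding lattice_sampling_trig[OF M assms(2)] A_def by (rule norm_sum)
  thus ?thesis using \<open>card A \<le> 1\<close> by simp
qed

section \<open>Termwise estimate of the sampling error\<close>

lemma has_sum_sum:
  fixes f :: "'i \<Rightarrow> 'a \<Rightarrow> 'b :: topological_comm_monoid_add"
  assumes "\<And>i. i \<in> I \<Longrightarrow> (f i has_sum s i) A"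
  shows "((\<lambda>x. \<Sum>i\<in>I. f i x) has_sum (\<Sum>i\<in>I. s i)) A"
  using assms by (induction I rule: infinite_finite_induct) (auto intro!: has_sum_add has_sum_0)

lemma norm_has_sum_le_finite_sums:
  fixes f :: "'a \<Rightarrow> 'b :: real_normed_vector"
  assumes "(f has_sum a) A" "\<And>F. finite F \<Longrightarrow> F \<subseteq> A \<Longrightarrow> (\<Sum>x\<in>F. norm (f x)) \<le> b"
  shows "norm a \<le> b"
proof (rule tendsto_upperbound)
  show "((\<lambda>F. norm (sum f F)) \<longlongrightarrow> norm a) (finite_subsets_at_top A)"
    using assms(1) by (intro tendsto_norm) (simp add: has_sum_def)
  show "\<forall>\<^sub>F F in finite_subsets_at_top A. norm (sum f F) \<le> b"
  proof (rule eventually_finite_subsets_at_top_weakI)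
    fix F assume "finite F" "F \<subseteq> A"
    from norm_sum[of f F] assms(2)[OF this] show "norm (sum f F) \<le> b" by (rule order_trans)
  qed
qed simp

theorem sampling_error_le:
  assumes rec: "reconstructing d z M I" and I: "finite I" "I \<noteq> {}"
    and ser: "\<And>x. ((\<lambda>k. c k * trig d k x) has_sum f x) A"
    and bound: "\<And>F. finite F \<Longrightarrow> F \<subseteq> A - I \<Longrightarrow> (\<Sum>k\<in>F. cmod (c k)) \<le> B"
  shows "cmod (f x - lattice_sampling d z M I f x) \<le> 2 * B"
proof -
  define E where "E h = trig d h x - lattice_sampling d z M I (trig d h) x" for h
  \<comment> \<open>Sampling is a finite combination of point evaluations, so it may be applied to
    the pointwise convergent series term by term.\<close>
  have "((\<lambda>h. c h * lattice_sampling d z M I (trig d h) x) has_sum lattice_sampling d z M I f x) A"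
  proof -
    have "((\<lambda>h. \<Sum>k\<in>I. \<Sum>j<M. (1 / of_nat M * cnj (trig d k (lattice_node z M j)) * trig d k x) *
              (c h * trig d h (lattice_node z M j)))
            has_sum (\<Sum>k\<in>I. \<Sum>j<M. (1 / of_nat M * cnj (trig d k (lattice_node z M j)) * trig d k x) *
              f (lattice_node z M j))) A"
      by (intro has_sum_sum has_sum_cmult_right ser)
    thus ?thesis
      by (simp add: lattice_sampling_def lattice_coeff_alt sum_distrib_left sum_distrib_right mult_ac)
  qed
  from has_sum_add[OF ser[of x] has_sum_cmult_right[OF this, of "- 1"]]
  have "((\<lambda>h. c h * E h) has_sum (f x - lattice_sampling d z M I f x)) A"
    by (simp add: E_def right_diff_distrib)
  hence "((\<lambda>h. c h * E h) has_sum (f x - lattice_sampling d z M I f x)) (A - I)"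
  proof (rule has_sum_cong_neutral[THEN iffD1, rotated -1])
    fix h assume "h \<in> A - (A - I)"
    thus "c h * E h = 0" by (simp add: E_def reconstructing_trig[OF rec I(1)])
  qed auto
  thus ?thesis
  proof (rule norm_has_sum_le_finite_sums)
    fix F assume F: "finite F" "F \<subseteq> A - I"
    have "(\<Sum>h\<in>F. norm (c h * E h)) \<le> (\<Sum>h\<in>F. cmod (c h) * 2)"
    proof (rule sum_mono)
      fix h
      have "norm (E h) \<le> norm (trig d h x) + norm (lattice_sampling d z M I (trig d h) x)"
        unfolding E_def by (rule norm_triangle_ineq4)
      also have "\<dots> \<le> 2" using norm_lattice_sampling_trig_le[OF rec I, of h x] by simp
      finally show "norm (c h * E h) \<le> cmod (c h) * 2" by (simp add: norm_mult mult_left_mono)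
    qed
    also have "\<dots> \<le> 2 * B" using bound[OF F] by (simp add: sum_distrib_right[symmetric])
    finally show "(\<Sum>h\<in>F. norm (c h * E h)) \<le> 2 * B" .
  qed
qed

section \<open>Summation over the complement of the hyperbolic cross\<close>

text \<open>The index of the block \<open>Qset j\<close> that contains \<open>k\<close>.\<close>

definition dyadic_level :: "int \<Rightarrow> nat" where
  "dyadic_level k = (LEAST j. \<bar>k\<bar> \<le> 2 ^ j)"

lemma abs_le_dyadic_level: "\<bar>k\<bar> \<le> 2 ^ dyadic_level k"
  unfolding dyadic_level_def
proof (rule LeastI_ex)
  have "\<bar>k\<bar> \<le> int (2 ^ nat \<bar>k\<bar>)"
    using less_exp[of "nat \<bar>k\<bar>"] by linarith
  thus "\<exists>j. \<bar>k\<bar> \<le> 2 ^ j" by auto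
qed

lemma less_dyadic_level: "j < dyadic_level k \<Longrightarrow> 2 ^ j < \<bar>k\<bar>"
  unfolding dyadic_level_def using not_less_Least not_le by blast

lemma Qset_dyadic_level: "k \<in> Qset (dyadic_level k)"
proof (cases "dyadic_level k")
  case 0
  thus ?thesis using abs_le_dyadic_level[of k] by (auto simp: Qset_def abs_if split: if_splits)
next
  case (Suc j)
  hence "2 ^ j < \<bar>k\<bar>" by (intro less_dyadic_level) simp
  moreover have "\<bar>k\<bar> \<le> 2 ^ Suc j" using abs_le_dyadic_level[of k] Suc by simp
  ultimately show ?thesis using Suc by (auto simp: Qset_def)
qed

text \<open>At level j >= 1 the modulus of \<open>k\<close> exceeds 2^(j-1). The factor
  \<open>4 powr \<alpha>\<close> pays for this shift by one level, and level 0 is covered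
  trivially.\<close>

lemma weight_le_dyadic_level:
  assumes "\<alpha> \<ge> 0"
  shows "(1 + \<bar>of_int k\<bar>\<^sup>2) powr - \<alpha> \<le> 4 powr \<alpha> * (2::real) powr (- (2 * \<alpha>) * real (dyadic_level k))"
proof -
  have "2 powr (2 * (real (dyadic_level k) - 1)) \<le> 1 + \<bar>real_of_int k\<bar>\<^sup>2"
  proof (cases "dyadic_level k")
    case 0
    have "(2::real) powr (2 * (0 - 1)) \<le> 2 powr 0" by (intro powr_mono) auto
    also have "\<dots> \<le> 1 + \<bar>real_of_int k\<bar>\<^sup>2" by simp
    finally show ?thesis using 0 by simp
  next
    case (Suc j)
    hence "2 ^ j < \<bar>k\<bar>" by (intro less_dyadic_level) simp
    hence "real_of_int (2 ^ j) \<le> real_of_int \<bar>k\<bar>" by (simp only: of_int_le_iff less_imp_le)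
    hence "(2 ^ j)\<^sup>2 \<le> \<bar>real_of_int k\<bar>\<^sup>2" by (intro power_mono) auto
    moreover have "(2::real) powr (2 * (real (dyadic_level k) - 1)) = (2 ^ j)\<^sup>2"
    proof -
      have "2 * (real (dyadic_level k) - 1) = real (2 * j)" by (simp add: Suc)
      thus ?thesis by (simp only: powr_realpow zero_less_numeral) (simp add: power_mult mult.commute flip: power_mult)
    qed
    ultimately show ?thesis by simp
  qed
  hence "(1 + \<bar>of_int k\<bar>\<^sup>2) powr - \<alpha> \<le> (2 powr (2 * (real (dyadic_level k) - 1))) powr - \<alpha>"
    using assms by (intro powr_mono2') auto
  also have "\<dots> = 2 powr (2 * \<alpha>) * 2 powr (- (2 * \<alpha>) * real (dyadic_level k))"
    by (simp add: powr_powr powr_add[symmetric] algebra_simps)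
  also have "(2::real) powr (2 * \<alpha>) = 4 powr \<alpha>"
    using powr_powr[of 2 2 \<alpha>] by simp
  finally show ?thesis .
qed

definition dyadic_box :: "nat \<Rightarrow> int set" where
  "dyadic_box m = {k. dyadic_level k < m}"

lemma finite_dyadic_level_le: "finite {k. dyadic_level k \<le> j}"
  and card_dyadic_level_le: "card {k. dyadic_level k \<le> j} \<le> 3 * 2 ^ j"
proof -
  have sub: "{k. dyadic_level k \<le> j} \<subseteq> {- (2 ^ j)..2 ^ j}"
  proof
    fix k assume "k \<in> {k. dyadic_level k \<le> j}"
    hence "(2::int) ^ dyadic_level k \<le> 2 ^ j" by (intro power_increasing) auto
    hence "\<bar>k\<bar> \<le> 2 ^ j" using abs_le_dyadic_level[of k] by (rule order_trans[rotated])
    thus "k \<in> {- (2 ^ j)..2 ^ j}" by (simp add: abs_le_iff)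
  qed
  show "finite {k. dyadic_level k \<le> j}" using sub finite_subset by blast
  have "card {k. dyadic_level k \<le> j} \<le> card {- (2 ^ j)..(2::int) ^ j}" by (intro card_mono sub) auto
  also have "\<dots> = nat (2 * 2 ^ j + 1)" by simp
  also have "\<dots> = 2 * 2 ^ j + 1" by (simp add: nat_add_distrib nat_mult_distrib nat_power_eq)
  also have "\<dots> \<le> 3 * 2 ^ j" using one_le_power[of "2::nat" j] by simp
  finally show "card {k. dyadic_level k \<le> j} \<le> 3 * 2 ^ j" .
qed

lemma finite_dyadic_box: "finite (dyadic_box m)"
  by (rule finite_subset[OF _ finite_dyadic_level_le[of m]]) (auto simp: dyadic_box_def)

text \<open>Grouping by level: at most \<open>3 * 2 ^ j\<close> integers have level
  \<open>j\<close>, and this growth turns the exponent \<open>2 * \<alpha>\<close> into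
  \<open>2 * \<alpha> - 1\<close>.\<close>

lemma sum_dyadic_box_le:
  assumes "\<And>j. F j \<ge> (0::real)" "\<alpha> \<ge> 0"
  shows "(\<Sum>k\<in>dyadic_box m. (1 + \<bar>of_int k\<bar>\<^sup>2) powr - \<alpha> * F (dyadic_level k)) \<le>
         3 * 4 powr \<alpha> * (\<Sum>j<m. 2 powr (- (2 * \<alpha> - 1) * real j) * F j)"
proof -
  have "(\<Sum>k\<in>dyadic_box m. (1 + \<bar>of_int k\<bar>\<^sup>2) powr - \<alpha> * F (dyadic_level k)) \<le>
        (\<Sum>k\<in>dyadic_box m. 4 powr \<alpha> * 2 powr (- (2 * \<alpha>) * real (dyadic_level k)) * F (dyadic_level k))"
    using assms by (intro sum_mono mult_right_mono weight_le_dyadic_level) auto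
  also have "\<dots> = (\<Sum>j<m. \<Sum>k | k \<in> dyadic_box m \<and> dyadic_level k = j.
                4 powr \<alpha> * 2 powr (- (2 * \<alpha>) * real (dyadic_level k)) * F (dyadic_level k))"
    by (rule sum.group[symmetric]) (auto simp: finite_dyadic_box, auto simp: dyadic_box_def)
  also have "\<dots> \<le> (\<Sum>j<m. 3 * 2 ^ j * (4 powr \<alpha> * 2 powr (- (2 * \<alpha>) * real j) * F j))"
  proof (rule sum_mono)
    fix j
    have "(\<Sum>k | k \<in> dyadic_box m \<and> dyadic_level k = j.
                4 powr \<alpha> * 2 powr (- (2 * \<alpha>) * real (dyadic_level k)) * F (dyadic_level k)) =
          real (card {k. k \<in> dyadic_box m \<and> dyadic_level k = j}) * (4 powr \<alpha> * 2 powr (- (2 * \<alpha>) * real j) * F j)"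
      by simp
    also have "card {k. k \<in> dyadic_box m \<and> dyadic_level k = j} \<le> card {k. dyadic_level k \<le> j}"
      by (intro card_mono finite_dyadic_level_le) auto
    also have "\<dots> \<le> 3 * 2 ^ j" by (rule card_dyadic_level_le)
    hence "real (card {k. dyadic_level k \<le> j}) \<le> real (3 * 2 ^ j)" by (simp only: of_nat_le_iff)
    finally show "(\<Sum>k | k \<in> dyadic_box m \<and> dyadic_level k = j.
                4 powr \<alpha> * 2 powr (- (2 * \<alpha>) * real (dyadic_level k)) * F (dyadic_level k)) \<le>
                3 * 2 ^ j * (4 powr \<alpha> * 2 powr (- (2 * \<alpha>) * real j) * F j)"
      using assms by (simp add: mult_right_mono)
  qed
  also have "\<dots> = 3 * 4 powr \<alpha> * (\<Sum>j<m. 2 powr (- (2 * \<alpha> - 1) * real j) * F j)"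
  proof -
    have "2 ^ j * 2 powr (- (2 * \<alpha>) * real j) = (2::real) powr (- (2 * \<alpha> - 1) * real j)" for j
    proof -
      have "(2::real) ^ j = 2 powr real j" by (simp add: powr_realpow)
      moreover have "real j + - (2 * \<alpha>) * real j = - (2 * \<alpha> - 1) * real j" by (simp add: algebra_simps)
      ultimately show ?thesis by (simp only: powr_add[symmetric])
    qed
    note pow = this
    have "3 * 2 ^ j * (4 powr \<alpha> * 2 powr (- (2 * \<alpha>) * real j) * F j) =
           3 * 4 powr \<alpha> * (2 powr (- (2 * \<alpha> - 1) * real j) * F j)" for j
      unfolding pow[symmetric] by (simp only: mult_ac)
    thus ?thesis by (simp only: sum_distrib_left)
  qed
  finally show ?thesis .
qed

section \<open>Tail sums of the inverse weights, one coordinate at a time\<close>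

text \<open>The cutoff \<open>m\<close> on the levels makes the sum finite; the final bounds are
  uniform in \<open>m\<close>. The threshold \<open>R\<close> may be negative, since splitting off
  coordinates lowers it.\<close>

definition tail_sum :: "(nat \<Rightarrow> real) \<Rightarrow> (nat \<Rightarrow> real) \<Rightarrow> nat \<Rightarrow> nat \<Rightarrow> real \<Rightarrow> real" where
  "tail_sum \<alpha> g m n R = (\<Sum>k\<in>{1..n} \<rightarrow>\<^sub>E dyadic_box m.
     if R < (\<Sum>s\<in>{1..n}. g s * real (dyadic_level (k s)))
     then \<Prod>s\<in>{1..n}. (1 + \<bar>of_int (k s)\<bar>\<^sup>2) powr - \<alpha> s else 0)"

lemma tail_sum_nonneg: "0 \<le> tail_sum \<alpha> g m n R"
  unfolding tail_sum_def by (intro sum_nonneg) (auto intro!: prod_nonneg)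

text \<open>Splitting off the last coordinate, whose level times its slope is deducted from the
  threshold for the others.\<close>

lemma tail_sum_Suc:
  "tail_sum \<alpha> g m (Suc n) R = (\<Sum>k\<in>dyadic_box m. (1 + \<bar>of_int k\<bar>\<^sup>2) powr - \<alpha> (Suc n) *
     tail_sum \<alpha> g m n (R - g (Suc n) * real (dyadic_level k)))"
proof -
  define F where "F k = (if R < (\<Sum>s\<in>{1..Suc n}. g s * real (dyadic_level (k s)))
     then \<Prod>s\<in>{1..Suc n}. (1 + \<bar>of_int (k s)\<bar>\<^sup>2) powr - \<alpha> s else (0::real))" for k :: "nat \<Rightarrow> int"
  have ins: "{1..Suc n} = insert (Suc n) {1..n}" by auto
  have "tail_sum \<alpha> g m (Suc n) R = sum F ({1..Suc n} \<rightarrow>\<^sub>E dyadic_box m)"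
    by (simp add: tail_sum_def F_def)
  also have "\<dots> = (\<Sum>(y, k)\<in>dyadic_box m \<times> ({1..n} \<rightarrow>\<^sub>E dyadic_box m). F (k(Suc n := y)))"
    unfolding ins PiE_insert_eq
    by (subst sum.reindex[OF inj_combinator]) (auto simp: o_def case_prod_unfold)
  also have "\<dots> = (\<Sum>y\<in>dyadic_box m. \<Sum>k\<in>{1..n} \<rightarrow>\<^sub>E dyadic_box m. F (k(Suc n := y)))"
    by (rule sum.cartesian_product[symmetric])
  also have "\<dots> = (\<Sum>y\<in>dyadic_box m. (1 + \<bar>of_int y\<bar>\<^sup>2) powr - \<alpha> (Suc n) *
     tail_sum \<alpha> g m n (R - g (Suc n) * real (dyadic_level y)))"
  proof (rule sum.cong[OF refl])
    fix y
    have "F (k(Suc n := y)) = (1 + \<bar>of_int y\<bar>\<^sup>2) powr - \<alpha> (Suc n) *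
       (if R - g (Suc n) * real (dyadic_level y) < (\<Sum>s\<in>{1..n}. g s * real (dyadic_level (k s)))
        then \<Prod>s\<in>{1..n}. (1 + \<bar>of_int (k s)\<bar>\<^sup>2) powr - \<alpha> s else 0)" for k
    proof -
      have "(\<Sum>s\<in>{1..n}. g s * real (dyadic_level ((k(Suc n := y)) s))) =
            (\<Sum>s\<in>{1..n}. g s * real (dyadic_level (k s)))" by (intro sum.cong) auto
      hence S: "(\<Sum>s\<in>{1..Suc n}. g s * real (dyadic_level ((k(Suc n := y)) s))) =
            g (Suc n) * real (dyadic_level y) + (\<Sum>s\<in>{1..n}. g s * real (dyadic_level (k s)))"
        unfolding ins by (subst sum.insert) auto
      have "(\<Prod>s\<in>{1..n}. (1 + \<bar>of_int ((k(Suc n := y)) s)\<bar>\<^sup>2) powr - \<alpha> s) =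
            (\<Prod>s\<in>{1..n}. (1 + \<bar>of_int (k s)\<bar>\<^sup>2) powr - \<alpha> s :: real)" by (intro prod.cong) auto
      hence P: "(\<Prod>s\<in>{1..Suc n}. (1 + \<bar>of_int ((k(Suc n := y)) s)\<bar>\<^sup>2) powr - \<alpha> s) =
            (1 + \<bar>of_int y\<bar>\<^sup>2) powr - \<alpha> (Suc n) * (\<Prod>s\<in>{1..n}. (1 + \<bar>of_int (k s)\<bar>\<^sup>2) powr - \<alpha> s :: real)"
        unfolding ins by (subst prod.insert) auto
      show ?thesis unfolding F_def S P by (simp add: diff_less_eq add.commute)
    qed
    thus "(\<Sum>k\<in>{1..n} \<rightarrow>\<^sub>E dyadic_box m. F (k(Suc n := y))) = (1 + \<bar>of_int y\<bar>\<^sup>2) powr - \<alpha> (Suc n) *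
       tail_sum \<alpha> g m n (R - g (Suc n) * real (dyadic_level y))"
      by (simp add: tail_sum_def sum_distrib_left)
  qed
  finally show ?thesis .
qed

lemma tail_sum_Suc_le:
  assumes "\<alpha> (Suc n) \<ge> 0"
  shows "tail_sum \<alpha> g m (Suc n) R \<le> 3 * 4 powr \<alpha> (Suc n) *
    (\<Sum>j<m. 2 powr (- (2 * \<alpha> (Suc n) - 1) * real j) * tail_sum \<alpha> g m n (R - g (Suc n) * real j))"
  unfolding tail_sum_Suc by (rule sum_dyadic_box_le) (auto simp: tail_sum_nonneg assms)

text \<open>
  The first critical coordinate (weight exponent and slope exactly balanced) costs no power
  of \<open>R\<close>, every further one costs one.
\<close>

definition tail_poly :: "nat \<Rightarrow> real \<Rightarrow> real" where
  "tail_poly p R = (if p = 0 then (if R < 0 then 1 else 0) else max 1 R ^ (p - 1))"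

lemma tail_poly_nonneg: "0 \<le> tail_poly p R"
  by (simp add: tail_poly_def)

lemma tail_poly_Suc_ge_1: "1 \<le> tail_poly (Suc p) R"
  by (simp add: tail_poly_def)

lemma tail_poly_mono: "p > 0 \<Longrightarrow> R \<le> R' \<Longrightarrow> tail_poly p R \<le> tail_poly p R'"
  by (auto simp: tail_poly_def intro!: power_mono)

text \<open>For \<open>p = 0\<close> all summands vanish, because \<open>R - real j\<close> is not
  negative. For \<open>p > 0\<close> at most R + 1 levels occur, each contributing at most
  \<open>tail_poly p R\<close>.\<close>

lemma sum_tail_poly_le:
  "(\<Sum>j | j < m \<and> real j \<le> R. tail_poly p (R - real j)) \<le> 2 * tail_poly (Suc p) R"
proof (cases "p = 0")
  case True
  thus ?thesis by (simp add: tail_poly_def)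
next
  case False
  show ?thesis
  proof (cases "R < 0")
    case True
    hence "{j. j < m \<and> real j \<le> R} = {}" by auto
    thus ?thesis using tail_poly_nonneg[of "Suc p" R] by (simp only: sum.empty)
  next
    case R: False
    have "(\<Sum>j | j < m \<and> real j \<le> R. tail_poly p (R - real j)) \<le>
          (\<Sum>j | j < m \<and> real j \<le> R. tail_poly p R)"
      using False by (intro sum_mono tail_poly_mono) auto
    also have "\<dots> = real (card {j. j < m \<and> real j \<le> R}) * tail_poly p R" by simp
    also have "\<dots> \<le> (2 * max 1 R) * tail_poly p R"
    proof (intro mult_right_mono tail_poly_nonneg)
      have "{j. j < m \<and> real j \<le> R} \<subseteq> {..nat \<lfloor>R\<rfloor>}" by (auto simp: le_nat_floor)
      from card_mono[OF _ this] have "card {j. j < m \<and> real j \<le> R} \<le> nat \<lfloor>R\<rfloor> + 1" by simp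
      hence "real (card {j. j < m \<and> real j \<le> R}) \<le> real (nat \<lfloor>R\<rfloor>) + 1" by linarith
      also have "\<dots> \<le> R + 1" using R by simp
      also have "\<dots> \<le> 2 * max 1 R" by simp
      finally show "real (card {j. j < m \<and> real j \<le> R}) \<le> 2 * max 1 R" .
    qed
    also have "\<dots> = 2 * tail_poly (Suc p) R"
      using False by (cases p) (auto simp: tail_poly_def)
    finally show ?thesis .
  qed
qed

section \<open>Geometric sums and the two induction steps for the tail\<close>

text \<open>For \<open>b > 0\<close>, the sum of the geometric series with ratio
  \<open>2 powr - b\<close>.\<close>

definition geo :: "real \<Rightarrow> real" where
  "geo b = 1 / (1 - 2 powr - b)"

lemma geo_pos: "b > 0 \<Longrightarrow> geo b > 0"
  using powr_less_mono[of "- b" 0 2] by (simp add: geo_def)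

lemma sum_powr_le_geo:
  assumes "b > 0" "finite A" "\<And>j. j \<in> A \<Longrightarrow> R \<le> real j"
  shows "(\<Sum>j\<in>A. 2 powr (- b * real j)) \<le> 2 powr (- b * R) * geo b"
proof -
  define x :: real where "x = 2 powr - b"
  have x: "0 < x" "x < 1" using powr_less_mono[of "- b" 0 2] assms(1) by (auto simp: x_def)
  have xj: "2 powr (- b * real j) = x ^ j" for j
    unfolding x_def by (subst powr_realpow[symmetric]) (auto simp: powr_powr)
  \<comment> \<open>The first admissible index. For negative \<open>R\<close> it is 0, and
    \<open>R \<le> real i\<close> still holds.\<close>
  define i where "i = nat \<lceil>R\<rceil>"
  have i: "j \<ge> i" if "j \<in> A" for j using assms(3)[OF that] by (simp add: i_def ceiling_le_iff)
  have "(\<Sum>j\<in>A. 2 powr (- b * real j)) = (\<Sum>j\<in>(\<lambda>j. j - i) ` A. x ^ i * x ^ j)"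
  proof (subst sum.reindex)
    show "inj_on (\<lambda>j. j - i) A" by (intro inj_onI) (simp add: i eq_diff_iff)
    show "(\<Sum>j\<in>A. 2 powr (- b * real j)) = sum ((\<lambda>j. x ^ i * x ^ j) \<circ> (\<lambda>j. j - i)) A"
      unfolding xj using i by (intro sum.cong) (auto simp: power_add[symmetric])
  qed
  also have "\<dots> = x ^ i * (\<Sum>j\<in>(\<lambda>j. j - i) ` A. x ^ j)" by (simp add: sum_distrib_left)
  also have "\<dots> \<le> 2 powr (- b * R) * geo b"
  proof (rule mult_mono)
    have "(\<Sum>j\<in>(\<lambda>j. j - i) ` A. x ^ j) \<le> (\<Sum>j. x ^ j)"
      using x assms(2) by (intro sum_le_suminf summable_geometric) auto
    also have "(\<Sum>j. x ^ j) = geo b" using x suminf_geometric[of x] by (simp add: geo_def x_def)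
    finally show "(\<Sum>j\<in>(\<lambda>j. j - i) ` A. x ^ j) \<le> geo b" .
    have "R \<le> real i" unfolding i_def by linarith
    thus "x ^ i \<le> 2 powr (- b * R)" unfolding xj[symmetric] using assms(1) by (intro powr_mono) auto
  qed (use x in \<open>auto intro: sum_nonneg\<close>)
  finally show ?thesis .
qed

lemma sum_powr_le_geo_0: "b > 0 \<Longrightarrow> (\<Sum>j<m. 2 powr (- b * real j)) \<le> geo b"
  using sum_powr_le_geo[of b "{..<m}" 0] by simp

text \<open>For levels \<open>j\<close> up to \<open>R\<close> the two exponentials multiply to
  \<open>2 powr (- a * R)\<close> whatever \<open>j\<close> is, so only the polynomial factors are
  summed. Beyond \<open>R\<close> the uniform bound \<open>C\<close> and a geometric series
  suffice.\<close>

lemma critical_step: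
  assumes "a > 0" "C \<ge> 0"
    and S: "\<And>R. S R \<le> C" "\<And>R. S R \<le> C * 2 powr (- a * R) * tail_poly p R"
  shows "(\<Sum>j<m. 2 powr (- a * real j) * S (R - real j)) \<le>
           C * (2 + geo a) * 2 powr (- a * R) * tail_poly (Suc p) R"
proof -
  define A where "A = {j. j < m \<and> real j \<le> R}"
  define B where "B = {j. j < m \<and> R < real j}"
  have "{..<m} = A \<union> B" by (auto simp: A_def B_def)
  hence split: "(\<Sum>j<m. 2 powr (- a * real j) * S (R - real j)) =
        (\<Sum>j\<in>A. 2 powr (- a * real j) * S (R - real j)) + (\<Sum>j\<in>B. 2 powr (- a * real j) * S (R - real j))"
  proof -
    have "finite A" "finite B" "A \<inter> B = {}" by (auto simp: A_def B_def)
    thus ?thesis unfolding \<open>{..<m} = A \<union> B\<close> by (rule sum.union_disjoint)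
  qed
  have "(\<Sum>j\<in>A. 2 powr (- a * real j) * S (R - real j)) \<le>
             (\<Sum>j\<in>A. C * 2 powr (- a * R) * tail_poly p (R - real j))"
  proof (rule sum_mono)
    fix j
    have "2 powr (- a * real j) * S (R - real j) \<le>
          2 powr (- a * real j) * (C * 2 powr (- a * (R - real j)) * tail_poly p (R - real j))"
      by (intro mult_left_mono S) auto
    also have "\<dots> = C * (2 powr (- a * real j) * 2 powr (- a * (R - real j))) * tail_poly p (R - real j)"
      by (simp add: mult_ac)
    also have "2 powr (- a * real j) * 2 powr (- a * (R - real j)) = 2 powr (- a * R)"
      unfolding powr_add[symmetric] by (simp add: algebra_simps)
    finally show "2 powr (- a * real j) * S (R - real j) \<le> C * 2 powr (- a * R) * tail_poly p (R - real j)" .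
  qed
  also have "\<dots> = C * 2 powr (- a * R) * (\<Sum>j\<in>A. tail_poly p (R - real j))"
    by (simp add: sum_distrib_left)
  also have "\<dots> \<le> C * 2 powr (- a * R) * (2 * tail_poly (Suc p) R)"
    unfolding A_def using assms(2) by (intro mult_left_mono sum_tail_poly_le) auto
  finally have A: "(\<Sum>j\<in>A. 2 powr (- a * real j) * S (R - real j)) \<le>
    C * 2 powr (- a * R) * (2 * tail_poly (Suc p) R)" .
  have "(\<Sum>j\<in>B. 2 powr (- a * real j) * S (R - real j)) \<le> (\<Sum>j\<in>B. 2 powr (- a * real j) * C)"
    by (intro sum_mono mult_left_mono S) auto
  also have "\<dots> = (\<Sum>j\<in>B. 2 powr (- a * real j)) * C" by (simp add: sum_distrib_right)
  also have "\<dots> \<le> (2 powr (- a * R) * geo a) * C"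
    using assms(1,2) by (intro mult_right_mono sum_powr_le_geo) (auto simp: B_def)
  also have "\<dots> \<le> (2 powr (- a * R) * geo a) * C * tail_poly (Suc p) R"
  proof -
    have "0 \<le> (2 powr (- a * R) * geo a) * C" using geo_pos[OF assms(1)] assms(2) by simp
    from mult_left_mono[OF tail_poly_Suc_ge_1[of p R] this] show ?thesis by (simp only: mult_1_right)
  qed
  finally have B: "(\<Sum>j\<in>B. 2 powr (- a * real j) * S (R - real j)) \<le>
    (2 powr (- a * R) * geo a) * C * tail_poly (Suc p) R" .
  have "C * (2 + geo a) * 2 powr (- a * R) * tail_poly (Suc p) R =
    C * 2 powr (- a * R) * (2 * tail_poly (Suc p) R) + (2 powr (- a * R) * geo a) * C * tail_poly (Suc p) R"
    by (simp add: algebra_simps)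
  thus ?thesis using split A B by linarith
qed

text \<open>After extracting \<open>2 powr (- a * R)\<close>, decay with rate
  \<open>b - a * g > 0\<close> in \<open>j\<close> is left over. It is summable, so no further power
  of \<open>R\<close> arises; \<open>p > 0\<close> makes \<open>tail_poly p\<close>
  monotone.\<close>

lemma subcritical_step:
  assumes "a * g < b" "g \<ge> 0" "C \<ge> 0" "p > 0"
    and S: "\<And>R. S R \<le> C * 2 powr (- a * R) * tail_poly p R"
  shows "(\<Sum>j<m. 2 powr (- b * real j) * S (R - g * real j)) \<le>
           C * geo (b - a * g) * 2 powr (- a * R) * tail_poly p R"
proof -
  have "(\<Sum>j<m. 2 powr (- b * real j) * S (R - g * real j)) \<le>
        (\<Sum>j<m. C * 2 powr (- a * R) * tail_poly p R * 2 powr (- (b - a * g) * real j))"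
  proof (rule sum_mono)
    fix j
    have "2 powr (- b * real j) * S (R - g * real j) \<le>
          2 powr (- b * real j) * (C * 2 powr (- a * (R - g * real j)) * tail_poly p (R - g * real j))"
      by (intro mult_left_mono S) auto
    also have "\<dots> \<le> 2 powr (- b * real j) * (C * 2 powr (- a * (R - g * real j)) * tail_poly p R)"
      using assms by (intro mult_left_mono tail_poly_mono) auto
    also have "\<dots> = C * (2 powr (- b * real j) * 2 powr (- a * (R - g * real j))) * tail_poly p R"
      by (simp add: mult_ac)
    also have "2 powr (- b * real j) * 2 powr (- a * (R - g * real j)) =
               2 powr (- a * R) * 2 powr (- (b - a * g) * real j)"
      unfolding powr_add[symmetric] by (simp add: algebra_simps)
    finally show "2 powr (- b * real j) * S (R - g * real j) \<le>
        C * 2 powr (- a * R) * tail_poly p R * 2 powr (- (b - a * g) * real j)" by (simp add: mult_ac)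
  qed
  also have "\<dots> = C * 2 powr (- a * R) * tail_poly p R * (\<Sum>j<m. 2 powr (- (b - a * g) * real j))"
    by (simp add: sum_distrib_left)
  also have "\<dots> \<le> C * 2 powr (- a * R) * tail_poly p R * geo (b - a * g)"
    using assms tail_poly_nonneg by (intro mult_left_mono sum_powr_le_geo_0) auto
  finally show ?thesis by (simp add: mult_ac)
qed

text \<open>Induction on the dimension, with critical coordinates first. The uniform bound is
  carried along because the critical step needs it for levels beyond \<open>R\<close>.\<close>

theorem tail_sum_bound:
  assumes a: "a > 0" and \<mu>: "1 \<le> \<mu>"
    and crit: "\<And>s. s \<in> {1..min \<mu> n} \<Longrightarrow> 2 * \<alpha> s - 1 = a \<and> g s = 1"
    and sub: "\<And>s. s \<in> {\<mu> + 1..n} \<Longrightarrow> a * g s < 2 * \<alpha> s - 1 \<and> g s \<ge> 0"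
  shows "\<exists>C\<ge>0. \<forall>m R. tail_sum \<alpha> g m n R \<le> C \<and>
            tail_sum \<alpha> g m n R \<le> C * 2 powr (- a * R) * tail_poly (min n \<mu>) R"
  using crit sub
proof (induction n)
  case 0
  \<comment> \<open>In dimension 0 the tail is the empty product 1 if \<open>R < 0\<close> and zero
    otherwise, which matches \<open>tail_poly 0\<close>.\<close>
  have "(1::real) \<le> 2 powr - (a * R)" if "R < 0" for R
    using powr_mono[of 0 "- (a * R)" 2] that a by (simp add: mult_nonneg_nonpos)
  thus ?case by (intro exI[of _ 1]) (auto simp: tail_sum_def tail_poly_def)
next
  case (Suc n)
  have "\<exists>C\<ge>0. \<forall>m R. tail_sum \<alpha> g m n R \<le> C \<and>
            tail_sum \<alpha> g m n R \<le> C * 2 powr (- a * R) * tail_poly (min n \<mu>) R"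
  proof (rule Suc.IH)
    fix s show "2 * \<alpha> s - 1 = a \<and> g s = 1" if "s \<in> {1..min \<mu> n}"
      by (rule Suc.prems(1)) (use that in auto)
    show "a * g s < 2 * \<alpha> s - 1 \<and> 0 \<le> g s" if "s \<in> {\<mu> + 1..n}"
      by (rule Suc.prems(2)) (use that in auto)
  qed
  then obtain C where C: "C \<ge> 0" "\<And>m R. tail_sum \<alpha> g m n R \<le> C"
    "\<And>m R. tail_sum \<alpha> g m n R \<le> C * 2 powr (- a * R) * tail_poly (min n \<mu>) R" by blast
  define b where "b = 2 * \<alpha> (Suc n) - 1"
  define D where "D = 3 * 4 powr \<alpha> (Suc n)"
  have D: "D \<ge> 0" by (simp add: D_def)
  have cases: "Suc n \<le> \<mu> \<and> b = a \<and> g (Suc n) = 1 \<or> \<mu> \<le> n \<and> a * g (Suc n) < b \<and> g (Suc n) \<ge> 0"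
    using Suc.prems(1)[of "Suc n"] Suc.prems(2)[of "Suc n"]
    by (cases "Suc n \<le> \<mu>") (simp_all add: b_def min_def)
  have b: "b > 0"
    using cases
  proof
    assume "\<mu> \<le> n \<and> a * g (Suc n) < b \<and> g (Suc n) \<ge> 0"
    moreover from this have "0 \<le> a * g (Suc n)" using a by simp
    ultimately show ?thesis by linarith
  qed (use a in simp)
  have le: "tail_sum \<alpha> g m (Suc n) R \<le> D * (\<Sum>j<m. 2 powr (- b * real j) * tail_sum \<alpha> g m n (R - g (Suc n) * real j))"
    for m R unfolding D_def b_def by (rule tail_sum_Suc_le) (use b in \<open>simp add: b_def\<close>)
  \<comment> \<open>The uniform bound persists in both cases, since \<open>b > 0\<close> makes the
    sum over levels converge.\<close>
  have total: "tail_sum \<alpha> g m (Suc n) R \<le> D * (C * geo b)" for m R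
  proof -
    have "(\<Sum>j<m. 2 powr (- b * real j) * tail_sum \<alpha> g m n (R - g (Suc n) * real j)) \<le>
          (\<Sum>j<m. 2 powr (- b * real j) * C)" by (intro sum_mono mult_left_mono C) auto
    also have "\<dots> = (\<Sum>j<m. 2 powr (- b * real j)) * C" by (simp add: sum_distrib_right)
    also have "\<dots> \<le> geo b * C" using b C(1) by (intro mult_right_mono sum_powr_le_geo_0)
    finally have "D * (\<Sum>j<m. 2 powr (- b * real j) * tail_sum \<alpha> g m n (R - g (Suc n) * real j)) \<le>
      D * (C * geo b)" using D by (intro mult_left_mono) (simp_all only: mult.commute)
    thus ?thesis using le[of m R] by (rule order_trans[rotated])
  qed
  have "\<exists>E\<ge>0. \<forall>m R. (\<Sum>j<m. 2 powr (- b * real j) * tail_sum \<alpha> g m n (R - g (Suc n) * real j)) \<le>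
          E * 2 powr (- a * R) * tail_poly (min (Suc n) \<mu>) R"
    using cases
  proof
    assume *: "Suc n \<le> \<mu> \<and> b = a \<and> g (Suc n) = 1"
    hence min: "min n \<mu> = n" "min (Suc n) \<mu> = Suc n" by auto
    show ?thesis
    proof (intro exI[of _ "C * (2 + geo a)"] conjI allI)
      fix m R
      show "(\<Sum>j<m. 2 powr (- b * real j) * tail_sum \<alpha> g m n (R - g (Suc n) * real j)) \<le>
          C * (2 + geo a) * 2 powr (- a * R) * tail_poly (min (Suc n) \<mu>) R"
        using critical_step[where a = a and C = C and S = "tail_sum \<alpha> g m n" and p = n and m = m and R = R]
          a C * by (simp add: min)
    qed (use C(1) geo_pos[OF a] in auto)
  next
    assume *: "\<mu> \<le> n \<and> a * g (Suc n) < b \<and> g (Suc n) \<ge> 0"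
    hence min: "min n \<mu> = \<mu>" "min (Suc n) \<mu> = \<mu>" by auto
    show ?thesis
    proof (intro exI[of _ "C * geo (b - a * g (Suc n))"] conjI allI)
      fix m R
      show "(\<Sum>j<m. 2 powr (- b * real j) * tail_sum \<alpha> g m n (R - g (Suc n) * real j)) \<le>
          C * geo (b - a * g (Suc n)) * 2 powr (- a * R) * tail_poly (min (Suc n) \<mu>) R"
        using subcritical_step[where a = a and b = b and g = "g (Suc n)" and C = C and p = \<mu> and
          S = "tail_sum \<alpha> g m n" and m = m and R = R] C * \<mu> by (simp add: min)
      show "0 \<le> C * geo (b - a * g (Suc n))"
        using C(1) geo_pos[of "b - a * g (Suc n)"] * by simp
    qed
  qed
  then obtain E where E: "E \<ge> 0" "\<And>m R. (\<Sum>j<m. 2 powr (- b * real j) * tail_sum \<alpha> g m n (R - g (Suc n) * real j)) \<le>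
          E * 2 powr (- a * R) * tail_poly (min (Suc n) \<mu>) R" by blast
  define C' where "C' = max (D * (C * geo b)) (D * E)"
  show ?case
  proof (intro exI[of _ C'] conjI allI)
    show "0 \<le> C'" using D E(1) by (simp add: C'_def le_max_iff_disj)
    fix m R
    show "tail_sum \<alpha> g m (Suc n) R \<le> C'" using total[of m R] by (simp add: C'_def le_max_iff_disj)
    have "tail_sum \<alpha> g m (Suc n) R \<le> D * (E * 2 powr (- a * R) * tail_poly (min (Suc n) \<mu>) R)"
      using le[of m R] mult_left_mono[OF E(2) D] by (rule order_trans)
    also have "\<dots> = D * E * (2 powr (- a * R) * tail_poly (min (Suc n) \<mu>) R)" by (simp add: mult_ac)
    also have "\<dots> \<le> C' * (2 powr (- a * R) * tail_poly (min (Suc n) \<mu>) R)"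
      using tail_poly_nonneg by (intro mult_right_mono) (auto simp: C'_def)
    finally show "tail_sum \<alpha> g m (Suc n) R \<le> C' * 2 powr (- a * R) * tail_poly (min (Suc n) \<mu>) R"
      by (simp add: mult.assoc)
  qed
qed

section \<open>The sampling error\<close>

lemma finite_Jset:
  assumes "\<And>s. s \<in> {1..d} \<Longrightarrow> \<gamma> s > 0" "d \<ge> 1"
  shows "finite (Jset d \<gamma> R)"
proof -
  have "Jset d \<gamma> R \<subseteq> (\<Pi>\<^sub>E s\<in>{1..d}. {..nat \<lfloor>\<gamma> 1 * R / \<gamma> s\<rfloor>})"
  proof
    fix j assume j: "j \<in> Jset d \<gamma> R"
    have sum: "(\<Sum>s\<in>{1..d}. \<gamma> s * real (j s)) \<le> \<gamma> 1 * R"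
      using j assms(1)[of 1] assms(2) by (simp add: Jset_def field_simps)
    have "j s \<le> nat \<lfloor>\<gamma> 1 * R / \<gamma> s\<rfloor>" if s: "s \<in> {1..d}" for s
    proof -
      have "\<gamma> s * real (j s) \<le> (\<Sum>s\<in>{1..d}. \<gamma> s * real (j s))"
        using s assms(1) by (intro member_le_sum) (auto simp: less_imp_le)
      hence "real (j s) \<le> \<gamma> 1 * R / \<gamma> s"
        using sum assms(1)[OF s] by (simp add: field_simps)
      thus ?thesis by (simp add: le_nat_floor)
    qed
    thus "j \<in> (\<Pi>\<^sub>E s\<in>{1..d}. {..nat \<lfloor>\<gamma> 1 * R / \<gamma> s\<rfloor>})"
      using j by (auto simp: Jset_def PiE_iff)
  qed
  thus ?thesis by (rule finite_subset) (intro finite_PiE, auto)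
qed

lemma finite_hyp_cross:
  assumes "\<And>s. s \<in> {1..d} \<Longrightarrow> \<gamma> s > 0" "d \<ge> 1"
  shows "finite (hyp_cross d \<gamma> R)"
  unfolding hyp_cross_def
  by (intro finite_UN_I finite_Jset finite_PiE assms) (auto simp: Qset_def)

text \<open>The vector of dyadic levels of \<open>k\<close> indexes a product block containing
  \<open>k\<close>; were it in \<open>Jset\<close>, \<open>k\<close> would lie in the cross.\<close>

lemma not_in_hyp_cross:
  assumes "\<gamma> 1 > 0" "k \<in> freqs d" "k \<notin> hyp_cross d \<gamma> R"
  shows "R < (\<Sum>s\<in>{1..d}. \<gamma> s / \<gamma> 1 * real (dyadic_level (k s)))"
proof (rule ccontr)
  define j where "j = (\<lambda>s\<in>{1..d}. dyadic_level (k s))"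
  assume "\<not> ?thesis"
  hence "(\<Sum>s\<in>{1..d}. \<gamma> s / \<gamma> 1 * real (dyadic_level (k s))) \<le> R" by simp
  also have "(\<Sum>s\<in>{1..d}. \<gamma> s / \<gamma> 1 * real (dyadic_level (k s))) = 1 / \<gamma> 1 * (\<Sum>s\<in>{1..d}. \<gamma> s * real (j s))"
    by (simp add: sum_distrib_left j_def)
  finally have "j \<in> Jset d \<gamma> R" by (simp add: Jset_def j_def)
  moreover have "k \<in> (\<Pi>\<^sub>E s\<in>{1..d}. Qset (j s))"
    using assms(2) by (auto simp: freqs_def PiE_iff j_def Qset_dyadic_level)
  ultimately show False using assms(3) by (auto simp: hyp_cross_def)
qed

text \<open>The block \<open>Qset n\<close> on the first axis, with n the integer part of
  \<open>R\<close>, lies in the cross and has exactly 2^n elements because n >= 1.\<close>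

lemma card_hyp_cross_ge:
  assumes "\<And>s. s \<in> {1..d} \<Longrightarrow> \<gamma> s > 0" "d \<ge> 1" "R \<ge> 1"
  shows "2 ^ nat \<lfloor>R\<rfloor> \<le> card (hyp_cross d \<gamma> R)"
proof -
  define n where "n = nat \<lfloor>R\<rfloor>"
  have n: "n \<ge> 1" "real n \<le> R" unfolding n_def using assms(3) by linarith+
  define j where "j = (\<lambda>s\<in>{1..d}. if s = 1 then n else 0)"
  have "(\<Sum>s\<in>{1..d}. \<gamma> s * real (j s)) = (\<Sum>s\<in>{1..d}. if s = 1 then \<gamma> s * real n else 0)"
    by (intro sum.cong) (auto simp: j_def)
  also have "\<dots> = \<gamma> 1 * real n" using assms(2) by simp
  finally have J: "j \<in> Jset d \<gamma> R" using assms(1)[of 1] assms(2) n by (simp add: Jset_def j_def)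
  have "2 ^ n = card (Qset n)"
  proof -
    obtain i where i: "n = Suc i" using n(1) by (cases n) auto
    have "card ({- (2 ^ Suc i) .. - (2 ^ i) - 1} \<union> {2 ^ i + 1 .. (2::int) ^ Suc i}) =
          card {- (2 ^ Suc i) .. - (2 ^ i) - (1::int)} + card {2 ^ i + 1 .. (2::int) ^ Suc i}"
    proof (rule card_Un_disjoint)
      have "(0::int) < 2 ^ i" by simp
      thus "{- (2 ^ Suc i) .. - (2 ^ i) - 1} \<inter> {2 ^ i + 1 .. (2::int) ^ Suc i} = {}" by auto
    qed auto
    also have "\<dots> = 2 * nat (2 ^ i)" by simp
    also have "\<dots> = 2 ^ n" by (simp add: i nat_power_eq)
    finally show ?thesis by (simp add: Qset_def i)
  qed
  also have "\<dots> = card ((\<lambda>q. \<lambda>s\<in>{1..d}. if s = 1 then q else 0) ` Qset n)"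
  proof (rule card_image[symmetric], rule inj_onI)
    fix p q :: int
    assume "(\<lambda>s\<in>{1..d}. if s = 1 then p else 0) = (\<lambda>s\<in>{1..d}. if s = 1 then q else 0)"
    from fun_cong[OF this, of 1] show "p = q" using assms(2) by simp
  qed
  also have "\<dots> \<le> card (hyp_cross d \<gamma> R)"
  proof (rule card_mono[OF finite_hyp_cross])
    have "(\<lambda>s\<in>{1..d}. if s = 1 then q else 0) \<in> (\<Pi>\<^sub>E s\<in>{1..d}. Qset (j s))" if "q \<in> Qset n" for q
      using that by (auto simp: j_def Qset_def)
    thus "(\<lambda>q. \<lambda>s\<in>{1..d}. if s = 1 then q else 0) ` Qset n \<subseteq> hyp_cross d \<gamma> R"
      using J unfolding hyp_cross_def by blast
  qed (use assms in auto)
  finally show ?thesis by (simp add: n_def)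
qed

section \<open>From the tail of the weights to the operator norm\<close>

text \<open>A finite set of frequencies fits into some dyadic box. The cutoff depends on
  \<open>F\<close>, which is why the tail bounds must be uniform in \<open>m\<close>.\<close>

lemma prod_inverse_weights_tail:
  assumes "\<gamma> 1 > 0" "finite F" "F \<subseteq> freqs d - hyp_cross d \<gamma> R"
  shows "\<exists>m. (\<Sum>k\<in>F. \<Prod>s\<in>{1..d}. (1 + \<bar>of_int (k s)\<bar>\<^sup>2) powr - \<alpha> s) \<le>
             tail_sum \<alpha> (\<lambda>s. \<gamma> s / \<gamma> 1) m d R"
proof -
  have "finite (\<Union>k\<in>F. (\<lambda>s. dyadic_level (k s)) ` {1..d})" using assms(2) by auto
  then obtain m where m: "(\<Union>k\<in>F. (\<lambda>s. dyadic_level (k s)) ` {1..d}) \<subseteq> {..<m}"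
    by (auto dest: finite_nat_bounded)
  let ?c = "\<lambda>k. R < (\<Sum>s\<in>{1..d}. \<gamma> s / \<gamma> 1 * real (dyadic_level (k s)))"
  let ?w = "\<lambda>k. \<Prod>s\<in>{1..d}. (1 + \<bar>real_of_int (k s)\<bar>\<^sup>2) powr - \<alpha> s"
  have "(\<Sum>k\<in>F. ?w k) = (\<Sum>k\<in>F. if ?c k then ?w k else 0)"
    using not_in_hyp_cross[where \<gamma> = \<gamma> and d = d and R = R] assms by (intro sum.cong) auto
  also have "\<dots> \<le> (\<Sum>k\<in>{1..d} \<rightarrow>\<^sub>E dyadic_box m. if ?c k then ?w k else 0)"
  proof (rule sum_mono2)
    show "F \<subseteq> {1..d} \<rightarrow>\<^sub>E dyadic_box m"
    proof
      fix k assume k: "k \<in> F"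
      hence "dyadic_level (k s) < m" if "s \<in> {1..d}" for s using m that by blast
      thus "k \<in> {1..d} \<rightarrow>\<^sub>E dyadic_box m"
        using k assms(3) by (auto simp: freqs_def PiE_iff dyadic_box_def)
    qed
  qed (auto intro!: finite_PiE finite_dyadic_box prod_nonneg)
  finally show ?thesis by (auto simp: tail_sum_def)
qed

text \<open>Cauchy-Schwarz after inserting the square root of the weight and its reciprocal.\<close>

lemma Hmix_sum_le:
  assumes "f \<in> Hmix d \<alpha>" "hmix_norm d \<alpha> f \<le> 1" "finite F" "F \<subseteq> freqs d"
    and "(\<Sum>k\<in>F. \<Prod>s\<in>{1..d}. (1 + \<bar>of_int (k s)\<bar>\<^sup>2) powr - \<alpha> s) \<le> B"
  shows "(\<Sum>k\<in>F. cmod (fourier_coeff d f k)) \<le> sqrt B"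
proof -
  define w where "w k = (\<Prod>s\<in>{1..d}. (1 + \<bar>real_of_int (k s)\<bar>\<^sup>2) powr \<alpha> s)" for k :: "nat \<Rightarrow> int"
  have one: "1 + \<bar>real_of_int i\<bar>\<^sup>2 > 0" for i using zero_le_power2[of "\<bar>real_of_int i\<bar>"] by linarith
  have w: "w k > 0" for k unfolding w_def using one by (intro prod_pos) (simp add: less_imp_neq[symmetric])
  have w_inv: "(\<Prod>s\<in>{1..d}. (1 + \<bar>real_of_int (k s)\<bar>\<^sup>2) powr - \<alpha> s) = inverse (w k)" for k
    unfolding w_def powr_minus
    using prod_inversef[of "\<lambda>s. (1 + \<bar>real_of_int (k s)\<bar>\<^sup>2) powr \<alpha> s" "{1..d}"] by (simp only: o_def)
  have summ: "hmix_term d \<alpha> f summable_on freqs d" using assms(1) by (simp add: Hmix_def)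
  have t: "hmix_term d \<alpha> f k = (cmod (fourier_coeff d f k) * sqrt (w k))\<^sup>2" for k
    using w[of k] by (simp add: hmix_term_def w_def power_mult_distrib)
  have "(\<Sum>k\<in>F. hmix_term d \<alpha> f k) \<le> (\<Sum>\<^sub>\<infinity>k\<in>freqs d. hmix_term d \<alpha> f k)"
    by (rule finite_sum_le_infsum[OF summ assms(3,4)]) (simp add: t)
  also have "\<dots> \<le> 1"
    using assms(2) unfolding hmix_norm_def by (simp add: real_sqrt_le_1_iff)
  finally have h1: "(\<Sum>k\<in>F. (cmod (fourier_coeff d f k) * sqrt (w k))\<^sup>2) \<le> 1" by (simp add: t)
  have "(\<Sum>k\<in>F. cmod (fourier_coeff d f k))\<^sup>2 =
        (\<Sum>k\<in>F. (cmod (fourier_coeff d f k) * sqrt (w k)) * (1 / sqrt (w k)))\<^sup>2"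
    using w by (simp add: less_imp_neq[symmetric])
  also have "\<dots> \<le> (\<Sum>k\<in>F. (cmod (fourier_coeff d f k) * sqrt (w k))\<^sup>2) * (\<Sum>k\<in>F. (1 / sqrt (w k))\<^sup>2)"
    by (rule Cauchy_Schwarz_ineq_sum)
  also have "(\<Sum>k\<in>F. (1 / sqrt (w k))\<^sup>2) = (\<Sum>k\<in>F. \<Prod>s\<in>{1..d}. (1 + \<bar>of_int (k s)\<bar>\<^sup>2) powr - \<alpha> s)"
    unfolding w_inv using w by (simp add: power_divide less_imp_le inverse_eq_divide)
  also have "(\<Sum>k\<in>F. (cmod (fourier_coeff d f k) * sqrt (w k))\<^sup>2) * \<dots> \<le> 1 * B"
    using h1 assms(5) by (intro mult_mono) (auto intro!: sum_nonneg prod_nonneg)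
  finally show ?thesis by (simp add: real_le_rsqrt)
qed

lemma opnorm_sampling_error_le:
  assumes d: "d \<ge> 1" and \<gamma>: "\<And>s. s \<in> {1..d} \<Longrightarrow> \<gamma> s > 0"
    and tail: "\<And>m. tail_sum \<alpha> (\<lambda>s. \<gamma> s / \<gamma> 1) m d R \<le> B"
    and total: "\<And>m. tail_sum \<alpha> (\<lambda>s. \<gamma> s / \<gamma> 1) m d (-1) \<le> C"
    and H: "hyp_cross d \<gamma> R \<noteq> {}"
    and rec: "reconstructing d z M (hyp_cross d \<gamma> R)"
  shows "opnorm_Hmix_Linf d \<alpha> (\<lambda>f x. f x - lattice_sampling d z M (hyp_cross d \<gamma> R) f x)
           \<le> ennreal (2 * sqrt B)"
  unfolding opnorm_Hmix_Linf_def
proof (rule SUP_least)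
  let ?I = "hyp_cross d \<gamma> R"
  have fin: "finite ?I" by (rule finite_hyp_cross[OF \<gamma> d])
  have \<gamma>1: "\<gamma> 1 > 0" using \<gamma>[of 1] d by simp
  fix f assume "f \<in> {f \<in> Hmix d \<alpha>. continuous_on UNIV f \<and> hmix_norm d \<alpha> f \<le> 1}"
  hence f: "f \<in> Hmix d \<alpha>" "continuous_on UNIV f" "hmix_norm d \<alpha> f \<le> 1" "f \<in> L2_torus d"
    by (auto simp: Hmix_def)
  \<comment> \<open>At threshold -1 the tail is the full sum, so \<open>total\<close> yields
    absolute summability of all Fourier coefficients.\<close>
  have empty: "hyp_cross d \<gamma> (-1) = {}"
  proof -
    have "(\<Sum>s\<in>{1..d}. \<gamma> s * real (j s)) \<ge> 0" for j
      using \<gamma> by (intro sum_nonneg mult_nonneg_nonneg) (auto simp: less_imp_le)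
    hence "1 / \<gamma> 1 * (\<Sum>s\<in>{1..d}. \<gamma> s * real (j s)) \<ge> 0" for j
      using \<gamma>1 by (intro mult_nonneg_nonneg) auto
    hence "\<not> 1 / \<gamma> 1 * (\<Sum>s\<in>{1..d}. \<gamma> s * real (j s)) \<le> -1" for j
      by (meson neg_0_le_iff_le not_one_le_zero order_trans)
    thus ?thesis unfolding hyp_cross_def Jset_def by blast
  qed
  have abs: "(\<lambda>k. cmod (fourier_coeff d f k)) summable_on freqs d"
  proof (rule nonneg_bdd_above_summable_on)
    show "bdd_above (sum (\<lambda>k. cmod (fourier_coeff d f k)) ` {F. F \<subseteq> freqs d \<and> finite F})"
    proof (rule bdd_aboveI2)
      fix F assume "F \<in> {F. F \<subseteq> freqs d \<and> finite F}"
      hence F: "finite F" "F \<subseteq> freqs d" by auto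
      with prod_inverse_weights_tail[where \<gamma> = \<gamma> and F = F and d = d and R = "-1" and \<alpha> = \<alpha>] \<gamma>1 total
      have "(\<Sum>k\<in>F. \<Prod>s\<in>{1..d}. (1 + \<bar>of_int (k s)\<bar>\<^sup>2) powr - \<alpha> s) \<le> C"
        by (auto simp: empty intro: order_trans)
      from Hmix_sum_le[OF f(1,3) F this]
      show "(\<Sum>k\<in>F. cmod (fourier_coeff d f k)) \<le> sqrt C" .
    qed
  qed simp
  have bound: "(\<Sum>k\<in>F. cmod (fourier_coeff d f k)) \<le> sqrt B" if F: "finite F" "F \<subseteq> freqs d - ?I" for F
  proof (rule Hmix_sum_le[OF f(1,3)])
    show "(\<Sum>k\<in>F. \<Prod>s\<in>{1..d}. (1 + \<bar>of_int (k s)\<bar>\<^sup>2) powr - \<alpha> s) \<le> B"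
      using prod_inverse_weights_tail[where \<gamma> = \<gamma> and F = F and d = d and R = R and \<alpha> = \<alpha>] \<gamma>1 F tail
      by (auto intro: order_trans)
  qed (use F in auto)
  have err: "cmod (f x - lattice_sampling d z M ?I f x) \<le> 2 * sqrt B" for x
    by (rule sampling_error_le[OF rec fin H fourier_series_has_sum[OF d f(4,2) abs] bound])
  have "f \<in> borel_measurable (torus d)" using f(4) by (simp add: L2_torus_def)
  hence "(\<lambda>x. f x - lattice_sampling d z M ?I f x) \<in> borel_measurable (torus d)"
    unfolding lattice_sampling_def by measurable
  thus "Linf_norm d (\<lambda>x. f x - lattice_sampling d z M ?I f x) \<le> ennreal (2 * sqrt B)"
    unfolding Linf_norm_def using err by (intro esssup_I) (auto intro!: ennreal_leI AE_I2)
qed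

section \<open>Passing from the refinement to the lattice size\<close>

text \<open>Raising the upper bound on \<open>M\<close> to the power -(a - 1/2)/2 recovers the
  exponential factor but leaves a negative power of \<open>R\<close>. The missing power, with
  exponent (\<mu> - 1)/2 (a + 1/2), is paid by powers of \<open>ln M\<close>, which is at least of
  order \<open>R\<close>.\<close>

lemma powr_lattice_size_bound:
  fixes R K a \<mu> M :: real
  assumes "a > 1/2" "R \<ge> 1" "K > 0" "M \<ge> 2" "M \<ge> 2 ^ nat \<lfloor>R\<rfloor>" "\<mu> \<ge> 1"
    and M: "M \<le> K * (2 powr (2 * R) * R powr (\<mu> - 1))"
  shows "2 powr (- (a - 1/2) * R) * R powr ((\<mu> - 1) / 2) \<le>
    K powr ((a - 1/2) / 2) * (2 / ln 2) powr ((\<mu> - 1) / 2 * (a + 1/2)) *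
      (M powr (- (a - 1/2) / 2) * ln M powr ((\<mu> - 1) / 2 * (a + 1/2)))"
proof -
  define p where "p = (\<mu> - 1) / 2"
  define b where "b = a - 1/2"
  have b: "b > 0" and p: "p \<ge> 0" using assms by (auto simp: b_def p_def)
  have exps: "a + 1/2 = b + 1" "(\<mu> - 1) / 2 = p" "\<mu> - 1 = 2 * p" "a - 1/2 = b"
    by (auto simp: p_def b_def)
  have lnM: "R \<le> 2 / ln 2 * ln M"
  proof -
    have "ln (2 ^ nat \<lfloor>R\<rfloor>) \<le> ln M" using assms by (intro ln_mono) auto
    hence "real (nat \<lfloor>R\<rfloor>) * ln 2 \<le> ln M" by (simp add: ln_realpow)
    moreover have "1 \<le> \<lfloor>R\<rfloor>" using assms(2) by simp
    \<comment> \<open>Rounding down loses at most a factor 2, because the integer part is at least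
      1.\<close>
    hence "R \<le> 2 * real (nat \<lfloor>R\<rfloor>)" by linarith
    hence "R * ln 2 \<le> 2 * real (nat \<lfloor>R\<rfloor>) * ln 2" by (intro mult_right_mono) auto
    ultimately have "R * ln 2 \<le> 2 * ln M" by linarith
    thus ?thesis by (simp add: field_simps)
  qed
  have "ln M > 0" using assms by simp
  have "(K * (2 powr (2 * R) * R powr (2 * p))) powr - (b / 2) \<le> M powr - (b / 2)"
    using M assms b unfolding exps by (intro powr_mono2') auto
  also have "(K * (2 powr (2 * R) * R powr (2 * p))) powr - (b / 2) =
      K powr - (b / 2) * 2 powr (- b * R) * R powr (- p * b)"
    using assms by (simp add: powr_mult powr_powr mult_ac)
  finally have 1: "K powr - (b / 2) * 2 powr (- b * R) * R powr (- p * b) \<le> M powr - (b / 2)" .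
  have "R powr (p * (b + 1)) \<le> (2 / ln 2 * ln M) powr (p * (b + 1))"
    using lnM assms b p by (intro powr_mono2) auto
  also have "\<dots> = (2 / ln 2) powr (p * (b + 1)) * ln M powr (p * (b + 1))"
    using \<open>ln M > 0\<close> by (intro powr_mult)
  finally have 2: "R powr (p * (b + 1)) \<le> (2 / ln 2) powr (p * (b + 1)) * ln M powr (p * (b + 1))" .
  have "2 powr (- b * R) * R powr p =
      K powr (b / 2) * ((K powr - (b / 2) * 2 powr (- b * R) * R powr (- p * b)) * R powr (p * (b + 1)))"
  proof -
    have "K powr (b / 2) * K powr - (b / 2) = 1" using assms by (simp add: powr_add[symmetric])
    moreover have "R powr (- p * b) * R powr (p * (b + 1)) = R powr p"
      unfolding powr_add[symmetric] by (simp add: algebra_simps)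
    moreover have "K powr (b / 2) * ((K powr - (b / 2) * 2 powr (- b * R) * R powr (- p * b)) * R powr (p * (b + 1))) =
      (K powr (b / 2) * K powr - (b / 2)) * 2 powr (- b * R) * (R powr (- p * b) * R powr (p * (b + 1)))"
      by (simp only: mult_ac)
    ultimately show ?thesis by (simp only: mult_1_left)
  qed
  also have "\<dots> \<le> K powr (b / 2) * (M powr - (b / 2) * ((2 / ln 2) powr (p * (b + 1)) * ln M powr (p * (b + 1))))"
    by (intro mult_left_mono mult_mono 1 2) auto
  finally show ?thesis unfolding exps by (simp add: mult_ac)
qed

text \<open>\<open>K\<close> stands for the implied constant in the bound on the number of lattice
  points. The order of quantifiers makes \<open>c\<^sub>1\<close> independent of \<open>K\<close>,
  whereas \<open>c\<^sub>2\<close> may depend on it; neither depends on \<open>R\<close>,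
  \<open>z\<close> or \<open>M\<close>.\<close>

theorem theorem7p6:
  fixes d \<mu> :: nat and \<alpha> \<gamma> :: "nat \<Rightarrow> real"
  assumes "2 \<le> d" and "1 \<le> \<mu>" and "\<mu> < d"
    and "1 / 2 < \<alpha> 1"
    and "\<forall>s\<in>{1..\<mu>}. \<alpha> s = \<alpha> 1 \<and> \<gamma> s = \<alpha> 1"
    and "\<alpha> \<mu> < \<alpha> (\<mu> + 1)"
    and "\<forall>s\<in>{\<mu> + 1..<d}. \<alpha> s \<le> \<alpha> (s + 1)"
    and "\<forall>s\<in>{\<mu> + 1..d}. \<alpha> 1 < \<gamma> s \<and> \<gamma> s < \<alpha> s"
  shows "\<exists>c\<^sub>1>0. \<forall>K>0. \<exists>c\<^sub>2>0. \<forall>(R::real)\<ge>1. \<forall>(z :: nat \<Rightarrow> int) (M :: nat).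
    reconstructing d z M (hyp_cross d \<gamma> R) \<and> cbc M (hyp_cross d \<gamma> R) d z \<longrightarrow>
      opnorm_Hmix_Linf d \<alpha> (\<lambda>f x. f x - lattice_sampling d z M (hyp_cross d \<gamma> R) f x)
        \<le> ennreal (c\<^sub>1 * (2 powr (- (\<alpha> 1 - 1 / 2) * R) * R powr ((real \<mu> - 1) / 2))) \<and>
      (real M \<le> K * (2 powr (2 * R) * R powr (real \<mu> - 1)) \<longrightarrow>
        2 powr (- (\<alpha> 1 - 1 / 2) * R) * R powr ((real \<mu> - 1) / 2)
          \<le> c\<^sub>2 * (real M powr (- (\<alpha> 1 - 1 / 2) / 2) *
                  ln (real M) powr ((real \<mu> - 1) / 2 * (\<alpha> 1 + 1 / 2))))"
proof -
  have \<mu>: "1 \<le> \<mu>" and a: "2 * \<alpha> 1 - 1 > 0" and d: "d \<ge> 1" using assms(1-4) by auto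
  have crit: "\<alpha> s = \<alpha> 1 \<and> \<gamma> s = \<alpha> 1" if "s \<in> {1..\<mu>}" for s using assms(5) that by blast
  have sub: "\<alpha> 1 < \<gamma> s \<and> \<gamma> s < \<alpha> s" if "s \<in> {\<mu> + 1..d}" for s using assms(8) that by blast
  have \<gamma>1: "\<gamma> 1 = \<alpha> 1" using crit[of 1] \<mu> by simp
  have \<gamma>: "\<gamma> s > 0" if "s \<in> {1..d}" for s
  proof (cases "s \<le> \<mu>")
    case True
    thus ?thesis using crit[of s] that assms(4) by auto
  next
    case False
    thus ?thesis using sub[of s] that assms(4) by auto
  qed
  have "\<exists>C\<ge>0. \<forall>m R. tail_sum \<alpha> (\<lambda>s. \<gamma> s / \<gamma> 1) m d R \<le> C \<and>
     tail_sum \<alpha> (\<lambda>s. \<gamma> s / \<gamma> 1) m d R \<le> C * 2 powr (- (2 * \<alpha> 1 - 1) * R) * tail_poly (min d \<mu>) R"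
  proof (rule tail_sum_bound[OF a \<mu>])
    fix s assume "s \<in> {1..min \<mu> d}"
    hence "\<alpha> s = \<alpha> 1 \<and> \<gamma> s = \<alpha> 1" by (intro crit) auto
    thus "2 * \<alpha> s - 1 = 2 * \<alpha> 1 - 1 \<and> \<gamma> s / \<gamma> 1 = 1" using \<gamma>1 assms(4) by simp
  next
    fix s assume "s \<in> {\<mu> + 1..d}"
    note s = sub[OF this]
    \<comment> \<open>Both strict inequalities for \<open>\<gamma> s\<close> enter here:
      \<open>\<gamma> s < \<alpha> s\<close> bounds the first term and
      \<open>\<alpha> 1 < \<gamma> s\<close> makes the subtracted quotient exceed 1.\<close>
    have "(2 * \<alpha> 1 - 1) * (\<gamma> s / \<gamma> 1) = 2 * \<gamma> s - \<gamma> s / \<alpha> 1"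
      using \<gamma>1 assms(4) by (simp add: field_simps)
    moreover have "1 < \<gamma> s / \<alpha> 1" using s assms(4) by simp
    ultimately have "(2 * \<alpha> 1 - 1) * (\<gamma> s / \<gamma> 1) < 2 * \<alpha> s - 1" using s by linarith
    thus "(2 * \<alpha> 1 - 1) * (\<gamma> s / \<gamma> 1) < 2 * \<alpha> s - 1 \<and> \<gamma> s / \<gamma> 1 \<ge> 0"
      using s \<gamma>1 assms(4) by simp
  qed
  then obtain C where C: "C \<ge> 0" "\<And>m R. tail_sum \<alpha> (\<lambda>s. \<gamma> s / \<gamma> 1) m d R \<le> C"
    "\<And>m R. tail_sum \<alpha> (\<lambda>s. \<gamma> s / \<gamma> 1) m d R \<le>
        C * 2 powr (- (2 * \<alpha> 1 - 1) * R) * tail_poly (min d \<mu>) R" by blast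
  define rate where "rate R = 2 powr (- (\<alpha> 1 - 1 / 2) * R) * R powr ((real \<mu> - 1) / 2)" for R
  \<comment> \<open>The added 1 keeps the constant positive even if \<open>C = 0\<close>.\<close>
  define c1 where "c1 = 2 * sqrt C + 1"
  define c2 where "c2 K = K powr ((\<alpha> 1 - 1 / 2) / 2) * (2 / ln 2) powr ((real \<mu> - 1) / 2 * (\<alpha> 1 + 1 / 2))" for K
  have op: "opnorm_Hmix_Linf d \<alpha> (\<lambda>f x. f x - lattice_sampling d z M (hyp_cross d \<gamma> R) f x)
              \<le> ennreal (c1 * rate R)"
    and size: "M \<ge> 2 \<and> real M \<ge> 2 ^ nat \<lfloor>R\<rfloor>"
    if R: "R \<ge> 1" and rec: "reconstructing d z M (hyp_cross d \<gamma> R)" for R z M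
  proof -
    have card: "2 ^ nat \<lfloor>R\<rfloor> \<le> card (hyp_cross d \<gamma> R)" by (rule card_hyp_cross_ge[OF \<gamma> d R])
    have H: "hyp_cross d \<gamma> R \<noteq> {}" using card by auto
    have le: "2 ^ nat \<lfloor>R\<rfloor> \<le> M"
      using reconstructing_card_le[OF rec finite_hyp_cross[OF \<gamma> d] H] card by simp
    have "1 \<le> nat \<lfloor>R\<rfloor>" using R by linarith
    hence "(2::nat) ^ 1 \<le> 2 ^ nat \<lfloor>R\<rfloor>" by (rule power_increasing) simp
    moreover have "real (2 ^ nat \<lfloor>R\<rfloor>) \<le> real M" using le by (simp only: of_nat_le_iff)
    ultimately show "M \<ge> 2 \<and> real M \<ge> 2 ^ nat \<lfloor>R\<rfloor>" using le by simp
    \<comment> \<open>The tail bound is \<open>C\<close> times the square of the rate, so the square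
      root from Cauchy-Schwarz returns the rate itself. Here \<open>R \<ge> 1\<close> removes the
      maximum in \<open>tail_poly\<close>.\<close>
    have rate2: "(rate R)\<^sup>2 = 2 powr (- (2 * \<alpha> 1 - 1) * R) * tail_poly (min d \<mu>) R"
    proof -
      have "(R powr ((real \<mu> - 1) / 2))\<^sup>2 = R powr real (\<mu> - 1)"
        using R \<mu> by (simp add: power2_eq_square flip: powr_add)
      also have "\<dots> = R ^ (\<mu> - 1)" using R by (simp add: powr_realpow)
      also have "\<dots> = tail_poly (min d \<mu>) R" using R \<mu> assms(3) by (simp add: tail_poly_def)
      finally have "(R powr ((real \<mu> - 1) / 2))\<^sup>2 = tail_poly (min d \<mu>) R" .
      moreover have "(2 powr (- (\<alpha> 1 - 1 / 2) * R))\<^sup>2 = 2 powr (- (2 * \<alpha> 1 - 1) * R)"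
        unfolding power2_eq_square powr_add[symmetric] by (simp add: algebra_simps)
      ultimately show ?thesis by (simp only: rate_def power_mult_distrib)
    qed
    have tail: "tail_sum \<alpha> (\<lambda>s. \<gamma> s / \<gamma> 1) m d R \<le> C * (rate R)\<^sup>2" for m
      using C(3)[of m R] by (simp only: rate2 mult.assoc)
    have "rate R \<ge> 0" by (simp add: rate_def)
    hence "2 * sqrt (C * (rate R)\<^sup>2) = 2 * sqrt C * rate R" by (simp add: real_sqrt_mult)
    also have "\<dots> \<le> c1 * rate R" using \<open>rate R \<ge> 0\<close> by (intro mult_right_mono) (auto simp: c1_def)
    finally have "ennreal (2 * sqrt (C * (rate R)\<^sup>2)) \<le> ennreal (c1 * rate R)" by (rule ennreal_leI)
    with opnorm_sampling_error_le[OF d \<gamma> tail C(2) H rec]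
    show "opnorm_Hmix_Linf d \<alpha> (\<lambda>f x. f x - lattice_sampling d z M (hyp_cross d \<gamma> R) f x)
              \<le> ennreal (c1 * rate R)" by (rule order_trans)
  qed
  have c2: "rate R \<le> c2 K * (real M powr (- (\<alpha> 1 - 1 / 2) / 2) *
                  ln (real M) powr ((real \<mu> - 1) / 2 * (\<alpha> 1 + 1 / 2)))"
    if "K > 0" "R \<ge> 1" "reconstructing d z M (hyp_cross d \<gamma> R)"
      "real M \<le> K * (2 powr (2 * R) * R powr (real \<mu> - 1))" for K R z M
    unfolding rate_def c2_def
    using size[OF that(2,3)] that \<mu> by (intro powr_lattice_size_bound[OF assms(4)]) auto
  show ?thesis
  proof (rule exI[of _ c1], intro conjI allI impI)
    show "c1 > 0" using C(1) by (simp add: c1_def add_nonneg_pos)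
    fix K :: real assume K: "K > 0"
    show "\<exists>c\<^sub>2>0. \<forall>R\<ge>1. \<forall>z M.
      reconstructing d z M (hyp_cross d \<gamma> R) \<and> cbc M (hyp_cross d \<gamma> R) d z \<longrightarrow>
      opnorm_Hmix_Linf d \<alpha> (\<lambda>f x. f x - lattice_sampling d z M (hyp_cross d \<gamma> R) f x)
        \<le> ennreal (c1 * (2 powr (- (\<alpha> 1 - 1 / 2) * R) * R powr ((real \<mu> - 1) / 2))) \<and>
      (real M \<le> K * (2 powr (2 * R) * R powr (real \<mu> - 1)) \<longrightarrow>
        2 powr (- (\<alpha> 1 - 1 / 2) * R) * R powr ((real \<mu> - 1) / 2)
          \<le> c\<^sub>2 * (real M powr (- (\<alpha> 1 - 1 / 2) / 2) *
                  ln (real M) powr ((real \<mu> - 1) / 2 * (\<alpha> 1 + 1 / 2))))"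
    proof (rule exI[of _ "c2 K"], intro conjI allI impI; (elim conjE)?)
      show "c2 K > 0" using K by (simp add: c2_def)
    qed (use op c2[OF K] in \<open>simp_all only: rate_def\<close>)
  qed
qed

end
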